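(* Let $n\ge3$ be an integer, $\overline\mu=\frac{(n-2)^2}{4}$, $\mu\in[0,\overline\mu)$, $c\le0$ and $\rho>0$. Then the problem $$\begin{cases}f''(r)+(n-1)f'(r)\,\mathbf{ct}_c(r)+\mu\dfrac{f(r)}{r^2}+1=0,\quad r\in(0,\rho],\\[4pt] f(\rho)=0,\qquad \displaystyle\int_0^\rho f'(r)^2r^{n-1}\,\mathrm dr<\infty\end{cases}$$ has a unique, non-negative, non-increasing solution belonging to $C^\infty(0,\rho)$ (i.e. it has exactly one solution, and this solution is non-negative, non-increasing and belongs to $C^\infty(0,\rho)$).
   Context: $\mathbf{ct}_c:(0,\infty)\to\mathbb R$ is defined by $\mathbf{ct}_c(r)=\frac1r$ if $c=0$ and $\mathbf{ct}_c(r)=\sqrt{-c}\coth(\sqrt{-c}\,r)$ if $c<0$. A solution is a twice differentiable function $f:(0,\rho]\to\mathbb R$ satisfying all the stated conditions. *)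

theory Defs
  imports "HOL-Analysis.Analysis"
begin

definition ct :: "real \<Rightarrow> real \<Rightarrow> real" where
  "ct c r = (if c = 0 then 1 / r
             else sqrt (- c) * (cosh (sqrt (- c) * r) / sinh (sqrt (- c) * r)))"

text \<open>
  A function on \<open>(0, \<rho>]\<close> is represented by a total function of which only the values
  on that interval matter; derivatives are taken within the interval, hence are
  one-sided at \<open>\<rho>\<close>. They are unique, so \<open>f1\<close> and \<open>f2\<close> are \<open>f'\<close> and \<open>f''\<close>.
\<close>

definition is_solution ::
  "nat \<Rightarrow> real \<Rightarrow> real \<Rightarrow> real \<Rightarrow> (real \<Rightarrow> real) \<Rightarrow> bool" where
  "is_solution n \<mu> c \<rho> f \<longleftrightarrow>
     (\<exists>f1 f2.
        (\<forall>r\<in>{0<..\<rho>}.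
           (f has_real_derivative f1 r) (at r within {0<..\<rho>}) \<and>
           (f1 has_real_derivative f2 r) (at r within {0<..\<rho>}) \<and>
           f2 r + (real n - 1) * f1 r * ct c r + \<mu> * (f r / r\<^sup>2) + 1 = 0) \<and>
        f \<rho> = 0 \<and>
        (\<integral>\<^sup>+r\<in>{0<..\<rho>}. ennreal ((f1 r)\<^sup>2 * r ^ (n - 1)) \<partial>lborel) < \<infinity>)"

text \<open>On an open set the values there of the iterated \<^const>\<open>deriv\<close> depend only on
  \<open>f\<close> restricted to that set.\<close>

definition smooth_on :: "real set \<Rightarrow> (real \<Rightarrow> real) \<Rightarrow> bool" where
  "smooth_on S f \<longleftrightarrow> (\<forall>k. (deriv ^^ k) f differentiable_on S)"

end

theory Submission
  imports Defs
begin

text \<open>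
  Put \<open>k = sqrt (- c)\<close> and \<open>S r = sinh (k r) / k\<close> (\<open>S r = r\<close> for \<open>k = 0\<close>), so that \<open>ct c = S' / S\<close>, and
  let \<open>a\<close> be the smaller root of \<open>a (n - 2 - a) = \<mu>\<close>. The substitution \<open>\<phi> = S powr - a * v\<close> turns the
  homogeneous equation into \<open>(p v')' = p q v\<close> with \<open>p = S powr (n - 1 - 2 a)\<close> and \<open>q\<close> non-negative and
  bounded, and the Volterra equation for the solution with \<open>v 0 = 1\<close>, \<open>v' 0 = 0\<close> is solved by monotone
  iteration. This gives a positive non-increasing homogeneous solution \<open>\<phi>\<close> comparable to
  \<open>r powr - a\<close>. Reduction of order yields the explicit solution
  \<open>\<phi>(r) * \<integral>\<^sub>r\<^sup>\<rho> (\<integral>\<^sub>0\<^sup>s S\<^sup>n\<^sup>-\<^sup>1 \<phi>) / (S\<^sup>n\<^sup>-\<^sup>1 \<phi>\<^sup>2)(s) ds\<close>, whose sign and monotonicity are evident. If \<open>g\<close> is the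
  difference of two solutions, then \<open>L = S\<^sup>n\<^sup>-\<^sup>1 (g' \<phi> - g \<phi>')\<close> is constant, and \<open>L \<noteq> 0\<close> forces
  \<open>\<bar>g'\<bar> \<ge> \<bar>L\<bar> / (S\<^sup>n\<^sup>-\<^sup>1 \<phi>)\<close>, which has infinite energy because \<open>2 a < n - 2\<close>.
\<close>

section \<open>Generalised hyperbolic functions\<close>

text \<open>The solution of \<open>S'' = k\<^sup>2 S\<close> with \<open>S 0 = 0\<close> and
  \<open>S' 0 = 1\<close>; its derivative is \<open>cs k\<close>. The case \<open>k = 0\<close> is
  separate because division by zero yields 0, not the limit \<open>r\<close>.\<close>

definition sn :: "real \<Rightarrow> real \<Rightarrow> real" where
  "sn k r = (if k = 0 then r else sinh (k * r) / k)"

definition cs :: "real \<Rightarrow> real \<Rightarrow> real" where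
  "cs k r = cosh (k * r)"

lemma ct_eq: "ct c r = cs (sqrt (- c)) r / sn (sqrt (- c)) r"
  by (simp add: ct_def sn_def cs_def)

lemma sn_0 [simp]: "sn k 0 = 0"
  by (simp add: sn_def)

lemma has_real_derivative_sn [derivative_intros]:
  assumes "(g has_real_derivative g') (at x within A)"
  shows "((\<lambda>x. sn k (g x)) has_real_derivative cs k (g x) * g') (at x within A)"
proof (cases "k = 0")
  case False
  have "((\<lambda>x. sinh (k * g x) / k) has_real_derivative cosh (k * g x) * (k * g') / k) (at x within A)"
    by (auto intro!: derivative_eq_intros assms)
  with False show ?thesis
    by (simp add: sn_def cs_def)
qed (use assms in \<open>simp add: sn_def cs_def\<close>)

lemma has_real_derivative_cs [derivative_intros]:
  assumes "(g has_real_derivative g') (at x within A)"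
  shows "((\<lambda>x. cs k (g x)) has_real_derivative k\<^sup>2 * sn k (g x) * g') (at x within A)"
  unfolding cs_def sn_def
  by (auto intro!: derivative_eq_intros assms simp: power2_eq_square)

lemma continuous_on_sn [continuous_intros]:
  "continuous_on A g \<Longrightarrow> continuous_on A (\<lambda>x. sn k (g x))"
  unfolding sn_def by (cases "k = 0") (auto intro!: continuous_intros)

lemma continuous_on_cs [continuous_intros]:
  "continuous_on A g \<Longrightarrow> continuous_on A (\<lambda>x. cs k (g x))"
  unfolding cs_def by (auto intro!: continuous_intros)

lemma cs_ge_1: "1 \<le> cs k r"
  by (simp add: cs_def cosh_real_ge_1)

lemma cs_squared: "(cs k r)\<^sup>2 = 1 + k\<^sup>2 * (sn k r)\<^sup>2"
  by (simp add: cs_def sn_def cosh_square_eq power_divide)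

lemma sn_mono: "r \<le> s \<Longrightarrow> sn k r \<le> sn k s"
  by (rule DERIV_nonneg_imp_nondecreasing[of r s])
    (auto intro!: exI derivative_eq_intros order.trans[OF _ cs_ge_1])

lemma sn_ge: "0 \<le> r \<Longrightarrow> r \<le> sn k r"
proof -
  assume "0 \<le> r"
  have "sn k 0 - 0 \<le> sn k r - r"
    by (rule DERIV_nonneg_imp_nondecreasing[OF \<open>0 \<le> r\<close>])
      (auto intro!: exI derivative_eq_intros cs_ge_1)
  then show ?thesis by simp
qed

lemma sn_nonneg: "0 \<le> r \<Longrightarrow> 0 \<le> sn k r"
  using sn_ge[of r k] by simp

lemma sn_pos: "0 < r \<Longrightarrow> 0 < sn k r"
  using sn_ge[of r k] by simp

text \<open>The difference \<open>r * cs k r - sn k r\<close> vanishes at 0 and has derivative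
  \<open>r * k\<^sup>2 * sn k r\<close>.\<close>

lemma sn_le: "0 \<le> r \<Longrightarrow> sn k r \<le> r * cs k r"
proof -
  assume r: "0 \<le> r"
  have "0 * cs k 0 - sn k 0 \<le> r * cs k r - sn k r"
    by (rule DERIV_nonneg_imp_nondecreasing[OF r])
      (auto intro!: exI derivative_eq_intros mult_nonneg_nonneg sn_nonneg)
  then show ?thesis by simp
qed

lemma cs_mono: "0 \<le> r \<Longrightarrow> r \<le> s \<Longrightarrow> cs k r \<le> cs k s"
  by (rule DERIV_nonneg_imp_nondecreasing[of r s])
    (auto intro!: exI derivative_eq_intros mult_nonneg_nonneg sn_nonneg)

text \<open>This comparison with the flat case makes the potential \<open>q\<close> of the
  transformed equation non-negative.\<close>

lemma cs_div_sn_ge: "0 < r \<Longrightarrow> 1 / r \<le> cs k r / sn k r"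
  using sn_le[of r k] sn_pos[of r k] by (simp add: field_simps)

section \<open>A regular singular Volterra equation\<close>

text \<open>A squeeze at the singular end point 0; it serves expressions whose factors are singular
  there but whose product tends to 0.\<close>

lemma continuous_on_extend_zero:
  fixes f g :: "real \<Rightarrow> real"
  assumes f: "continuous_on {0<..R} f" "f 0 = 0"
    and g: "continuous_on {0..R} g" "g 0 = 0"
    and le: "\<And>t. 0 < t \<Longrightarrow> t \<le> R \<Longrightarrow> \<bar>f t\<bar> \<le> g t"
  shows "continuous_on {0..R} f"
  unfolding continuous_on_def
proof
  fix s assume s: "s \<in> {0..R}"
  show "(f \<longlongrightarrow> f s) (at s within {0..R})"
  proof (cases "s = 0")
    case True
    have "(f \<longlongrightarrow> 0) (at 0 within {0..R})"
    proof (rule Lim_null_comparison)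
      show "eventually (\<lambda>t. norm (f t) \<le> g t) (at 0 within {0..R})"
        using le by (auto simp: eventually_at_filter)
      show "(g \<longlongrightarrow> 0) (at 0 within {0..R})"
        using bspec[OF g(1)[unfolded continuous_on_def] s] g(2) True by simp
    qed
    with True f show ?thesis by simp
  next
    case False
    have "at s within {0..R} = at s within {0<..R}"
      by (rule at_within_nhd[of s "{0<..}"]) (use s False in auto)
    then show ?thesis
      using f s False by (auto simp: continuous_on_def)
  qed
qed

text \<open>Monotonicity of \<open>P\<close> bounds the integrand on \<open>{0..s}\<close> by the
  constant \<open>B * P s\<close>, so the quotient is at most \<open>B * s\<close> and tends to 0.
  At \<open>s = 0\<close> the integral is 0, hence the quotient is 0 whatever \<open>P 0\<close>
  is.\<close>

lemma
  fixes P g :: "real \<Rightarrow> real"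
  assumes g: "g integrable_on {0..R}"
    and bound: "\<And>t. t \<in> {0..R} \<Longrightarrow> \<bar>g t\<bar> \<le> B * P t"
    and mono: "\<And>s t. 0 \<le> s \<Longrightarrow> s \<le> t \<Longrightarrow> t \<le> R \<Longrightarrow> P s \<le> P t"
    and pos: "\<And>t. 0 < t \<Longrightarrow> t \<le> R \<Longrightarrow> 0 < P t"
    and B: "0 \<le> B"
    and P: "continuous_on {0..R} P"
  shows weighted_primitive_bound: "\<And>s. s \<in> {0..R} \<Longrightarrow> \<bar>integral {0..s} g / P s\<bar> \<le> B * s"
    and continuous_on_weighted_primitive:
      "continuous_on {0..R} (\<lambda>s. integral {0..s} g / P s)"
proof -
  show *: "\<bar>integral {0..s} g / P s\<bar> \<le> B * s" if s: "s \<in> {0..R}" for s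
  proof (cases "s = 0")
    case False
    have "norm (integral {0..s} g) \<le> integral {0..s} (\<lambda>_. B * P s)"
    proof (rule integral_norm_bound_integral)
      show "g integrable_on {0..s}"
        by (rule integrable_subinterval_real[OF g]) (use s in auto)
      show "norm (g t) \<le> B * P s" if "t \<in> {0..s}" for t
        using bound[of t] mono[of t s] that s B mult_left_mono[of "P t" "P s" B] by auto
    qed auto
    also have "\<dots> = B * s * P s"
      using s by simp
    finally show ?thesis
      using pos[of s] s False by (simp add: field_simps)
  qed auto
  have int: "continuous_on {0..R} (\<lambda>s. integral {0..s} g)"
    by (rule indefinite_integral_continuous_1[OF g])
  show "continuous_on {0..R} (\<lambda>s. integral {0..s} g / P s)"
  proof (rule continuous_on_extend_zero)
    show "continuous_on {0<..R} (\<lambda>s. integral {0..s} g / P s)"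
    proof (rule continuous_on_divide)
      show "\<forall>s\<in>{0<..R}. P s \<noteq> 0"
        using pos by fastforce
    qed (auto intro: continuous_on_subset[OF int] continuous_on_subset[OF P])
    show "continuous_on {0..R} (\<lambda>s. B * s)"
      by (intro continuous_intros)
  qed (use * in auto)
qed

text \<open>The map \<open>g \<mapsto> 1 + \<integral>\<^sub>0\<^sup>r (\<integral>\<^sub>0\<^sup>s K g) / P(s) ds\<close> is monotone, and \<open>exp (\<Lambda> r)\<close> is a supersolution,
  so the iterates starting at \<open>1\<close> increase to a fixed point.\<close>

lemma volterra_solution:
  fixes P K :: "real \<Rightarrow> real"
  assumes R: "0 < R" and \<Lambda>: "0 < \<Lambda>"
    and P: "continuous_on {0..R} P"
    and mono: "\<And>s t. 0 \<le> s \<Longrightarrow> s \<le> t \<Longrightarrow> t \<le> R \<Longrightarrow> P s \<le> P t"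
    and pos: "\<And>t. 0 < t \<Longrightarrow> t \<le> R \<Longrightarrow> 0 < P t"
    and K: "continuous_on {0..R} K"
    and K0: "\<And>t. t \<in> {0..R} \<Longrightarrow> 0 \<le> K t"
    and K1: "\<And>t. t \<in> {0..R} \<Longrightarrow> K t \<le> \<Lambda>\<^sup>2 * P t"
  obtains v h where
    "\<And>s. h s = integral {0..s} (\<lambda>t. K t * v t) / P s"
    "\<And>s. s \<in> {0..R} \<Longrightarrow> (v has_real_derivative h s) (at s within {0..R})"
    "\<And>s. s \<in> {0..R} \<Longrightarrow> 1 \<le> v s" "\<And>s. s \<in> {0..R} \<Longrightarrow> v s \<le> exp (\<Lambda> * R)"
    "\<And>s. s \<in> {0..R} \<Longrightarrow> 0 \<le> h s" "\<And>s. s \<in> {0..R} \<Longrightarrow> h s \<le> \<Lambda> * exp (\<Lambda> * R)"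
proof -
  define H where "H g s = integral {0..s} (\<lambda>t. K t * g t) / P s" for g s
  define F where "F g r = 1 + integral {0..r} (H g)" for g r
  \<comment> \<open>Only integrability of \<open>K g\<close> is demanded, because the pointwise
    limit of the iterates is not known to be continuous before the fixed point equation is
    available.\<close>
  define adm where "adm g \<longleftrightarrow> (\<lambda>t. K t * g t) integrable_on {0..R} \<and>
    (\<forall>t\<in>{0..R}. 1 \<le> g t \<and> g t \<le> exp (\<Lambda> * t))" for g
  have exp_le: "exp (\<Lambda> * s) \<le> exp (\<Lambda> * R)" if "s \<in> {0..R}" for s
    using that \<Lambda> by simp
  have adm_nonneg: "0 \<le> g t" if "adm g" "t \<in> {0..R}" for g t
    using that by (meson adm_def order.trans zero_le_one)
  \<comment> \<open>Positivity is assumed only away from 0; the end point is covered by squeezing 0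
    below \<open>\<Lambda>\<^sup>2 * P s\<close> through \<open>K\<close>.\<close>
  have P0: "0 \<le> P s" if "s \<in> {0..R}" for s
    using order.trans[OF K0[OF that] K1[OF that]] \<Lambda> by (simp add: zero_le_mult_iff)
  have Kint: "(\<lambda>t. K t * g t) integrable_on {0..s}" if "adm g" "s \<in> {0..R}" for g s
    by (rule integrable_subinterval_real[of _ 0 R]) (use that in \<open>auto simp: adm_def\<close>)
  have H_cont: "continuous_on {0..R} (H g)" if g: "adm g" for g
    unfolding H_def
  proof (rule continuous_on_weighted_primitive[OF _ _ mono pos _ P])
    show "(\<lambda>t. K t * g t) integrable_on {0..R}"
      using g by (simp add: adm_def)
    show "\<bar>K t * g t\<bar> \<le> (\<Lambda>\<^sup>2 * exp (\<Lambda> * R)) * P t" if t: "t \<in> {0..R}" for t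
    proof -
      have "g t \<le> exp (\<Lambda> * R)"
        using g t exp_le[OF t] unfolding adm_def by (meson order.trans)
      then have "K t * g t \<le> (\<Lambda>\<^sup>2 * P t) * exp (\<Lambda> * R)"
        using K0[OF t] K1[OF t] adm_nonneg[OF g t] by (intro mult_mono) auto
      moreover have "0 \<le> K t * g t"
        using K0[OF t] adm_nonneg[OF g t] by simp
      ultimately show ?thesis by (simp add: mult_ac)
    qed
  qed auto
  have H_mono: "H g s \<le> H g' s" if "adm g" "adm g'" "s \<in> {0..R}" "\<And>t. t \<in> {0..R} \<Longrightarrow> g t \<le> g' t"
    for g g' s
  proof -
    have "integral {0..s} (\<lambda>t. K t * g t) \<le> integral {0..s} (\<lambda>t. K t * g' t)"
      using that K0 by (intro integral_le Kint mult_left_mono) auto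
    then show ?thesis
      using P0[OF that(3)] by (simp add: H_def divide_right_mono)
  qed
  have H_nonneg: "0 \<le> H g s" if "adm g" "s \<in> {0..R}" for g s
  proof -
    have "0 \<le> K t * g t" if "t \<in> {0..s}" for t
      using K0[of t] adm_nonneg[OF \<open>adm g\<close>, of t] that \<open>s \<in> {0..R}\<close> by simp
    then show ?thesis
      using integral_nonneg[OF Kint[OF that]] P0[OF that(2)] by (simp add: H_def)
  qed
  have exp_int: "\<Lambda> * integral {0..s} (\<lambda>t. exp (\<Lambda> * t)) = exp (\<Lambda> * s) - 1" if "0 \<le> s" for s
  proof -
    have "((\<lambda>t. exp (\<Lambda> * t)) has_real_derivative \<Lambda> * exp (\<Lambda> * t)) (at t within {0..s})" for t
      by (auto intro!: derivative_eq_intros)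
    then have "((\<lambda>t. \<Lambda> * exp (\<Lambda> * t)) has_integral (exp (\<Lambda> * s) - 1)) {0..s}"
      using fundamental_theorem_of_calculus[OF that, of "\<lambda>t. exp (\<Lambda> * t)" "\<lambda>t. \<Lambda> * exp (\<Lambda> * t)"]
      by (simp add: has_real_derivative_iff_has_vector_derivative)
    then show ?thesis
      by (simp flip: integral_mult_right add: integral_unique)
  qed
  \<comment> \<open>The supersolution property of \<open>exp (\<Lambda> t)\<close>: replacing
    \<open>P t\<close> by the larger \<open>P s\<close> lets the weight cancel, and one integration
    of the exponential absorbs one factor \<open>\<Lambda>\<close>.\<close>
  have H_le: "H g s \<le> \<Lambda> * exp (\<Lambda> * s)" if g: "adm g" and s: "s \<in> {0..R}" for g s
  proof (cases "s = 0")
    case False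
    have "integral {0..s} (\<lambda>t. K t * g t) \<le> integral {0..s} (\<lambda>t. (\<Lambda> * P s) * (\<Lambda> * exp (\<Lambda> * t)))"
    proof (rule integral_le[OF Kint[OF g s]])
      show "(\<lambda>t. (\<Lambda> * P s) * (\<Lambda> * exp (\<Lambda> * t))) integrable_on {0..s}"
        by (intro integrable_continuous_real continuous_intros)
      fix t assume t: "t \<in> {0..s}"
      have "K t \<le> \<Lambda>\<^sup>2 * P s"
        using K1[of t] mult_left_mono[OF mono[of t s], of "\<Lambda>\<^sup>2"] t s by simp
      then have "K t * g t \<le> (\<Lambda>\<^sup>2 * P s) * exp (\<Lambda> * t)"
        using g t s adm_nonneg[OF g, of t] P0[OF s] by (intro mult_mono) (auto simp: adm_def)
      then show "K t * g t \<le> (\<Lambda> * P s) * (\<Lambda> * exp (\<Lambda> * t))"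
        by (simp add: power2_eq_square mult_ac)
    qed
    also have "\<dots> = (\<Lambda> * P s) * (exp (\<Lambda> * s) - 1)"
      using exp_int[of s] s by simp
    finally have "H g s \<le> \<Lambda> * (exp (\<Lambda> * s) - 1)"
      using pos[of s] s False by (simp add: H_def field_simps)
    also have "\<dots> \<le> \<Lambda> * exp (\<Lambda> * s)"
      using \<Lambda> by simp
    finally show ?thesis .
  qed (use \<Lambda> in \<open>simp add: H_def\<close>)
  have H_int: "H g integrable_on {0..r}" if "adm g" "r \<in> {0..R}" for g r
    by (intro integrable_continuous_real continuous_on_subset[OF H_cont[OF that(1)]]) (use that in auto)
  have F_deriv: "(F g has_real_derivative H g r) (at r within {0..R})" if "adm g" "r \<in> {0..R}" for g r
    unfolding F_def using integral_has_real_derivative[OF H_cont[OF that(1)] that(2)]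
    by (auto intro!: derivative_eq_intros)
  have F_cont: "continuous_on {0..R} (F g)" if "adm g" for g
    using DERIV_continuous_on[of "{0..R}" "F g" "H g"] F_deriv[OF that] by blast
  have F_adm: "adm (F g)" if g: "adm g" for g
    unfolding adm_def
  proof (intro conjI ballI)
    show "(\<lambda>t. K t * F g t) integrable_on {0..R}"
      by (intro integrable_continuous_real continuous_intros K F_cont g)
    fix r assume r: "r \<in> {0..R}"
    show "1 \<le> F g r"
      using integral_nonneg[OF H_int[OF g r]] H_nonneg[OF g] r by (simp add: F_def)
    have "integral {0..r} (H g) \<le> integral {0..r} (\<lambda>t. \<Lambda> * exp (\<Lambda> * t))"
      using r by (intro integral_le H_int g integrable_continuous_real continuous_intros H_le) auto
    with exp_int[of r] r show "F g r \<le> exp (\<Lambda> * r)"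
      by (simp add: F_def)
  qed
  have F_mono: "F g r \<le> F g' r" if "adm g" "adm g'" "r \<in> {0..R}" "\<And>t. t \<in> {0..R} \<Longrightarrow> g t \<le> g' t"
    for g g' r
    unfolding F_def using that by (intro add_left_mono integral_le H_int H_mono) auto
  define w where "w j = (F ^^ j) (\<lambda>_. 1)" for j
  have w_Suc: "w (Suc j) = F (w j)" for j
    by (simp add: w_def)
  have w_adm: "adm (w j)" for j
  proof (induction j)
    case 0
    show ?case
      using \<Lambda> K by (auto simp: w_def adm_def intro!: integrable_continuous_real)
  next
    case (Suc j)
    then show ?case by (simp add: w_Suc F_adm)
  qed
  have w_step: "w j r \<le> w (Suc j) r" if "r \<in> {0..R}" for j r
    using that
  proof (induction j arbitrary: r)
    case 0
    then show ?case
      using w_adm[of 1] by (simp add: w_def adm_def)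
  next
    case (Suc j)
    then show ?case
      using F_mono[OF w_adm[of j] w_adm[of "Suc j"]] by (simp only: w_Suc[of j] w_Suc[of "Suc j"])
  qed
  define v where "v r = (SUP j. w j r)" for r
  have w_lim: "(\<lambda>j. w j r) \<longlonglongrightarrow> v r" if "r \<in> {0..R}" for r
    unfolding v_def
  proof (rule LIMSEQ_incseq_SUP)
    show "bdd_above (range (\<lambda>j. w j r))"
      using w_adm that by (auto simp: adm_def intro!: bdd_aboveI[of _ "exp (\<Lambda> * r)"])
    show "incseq (\<lambda>j. w j r)"
      using w_step[OF that] by (rule incseq_SucI)
  qed
  have bounds: "1 \<le> w j t" "w j t \<le> exp (\<Lambda> * t)" if "t \<in> {0..R}" for j t
    using w_adm[of j] that by (auto simp: adm_def)
  have norm_le: "norm (K t * w j t) \<le> K t * exp (\<Lambda> * t)" if "t \<in> {0..R}" for j t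
    using bounds[OF that, of j] K0[OF that] by (auto simp: abs_mult intro!: mult_left_mono)
  have Kexp: "(\<lambda>t. K t * exp (\<Lambda> * t)) integrable_on {0..s}" if "s \<in> {0..R}" for s
    by (intro integrable_continuous_real continuous_intros continuous_on_subset[OF K])
      (use that in auto)
  have Kw_lim: "(\<lambda>t. K t * v t) integrable_on {0..s}"
    "(\<lambda>j. integral {0..s} (\<lambda>t. K t * w j t)) \<longlonglongrightarrow> integral {0..s} (\<lambda>t. K t * v t)"
    if s: "s \<in> {0..R}" for s
  proof -
    have *: "norm (K t * w j t) \<le> K t * exp (\<Lambda> * t)" "(\<lambda>j. K t * w j t) \<longlonglongrightarrow> K t * v t"
      if "t \<in> {0..s}" for j t
      using that s by (intro norm_le tendsto_mult_left w_lim; simp)+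
    show "(\<lambda>t. K t * v t) integrable_on {0..s}"
      "(\<lambda>j. integral {0..s} (\<lambda>t. K t * w j t)) \<longlonglongrightarrow> integral {0..s} (\<lambda>t. K t * v t)"
      using dominated_convergence[OF Kint[OF w_adm s] Kexp[OF s] *] by blast+
  qed
  have v_adm: "adm v"
    unfolding adm_def
  proof (intro conjI ballI)
    show "(\<lambda>t. K t * v t) integrable_on {0..R}"
      using Kw_lim(1)[of R] R by simp
    fix t assume t: "t \<in> {0..R}"
    show "1 \<le> v t"
      by (rule LIMSEQ_le_const[OF w_lim[OF t]]) (use bounds t in auto)
    show "v t \<le> exp (\<Lambda> * t)"
      by (rule LIMSEQ_le_const2[OF w_lim[OF t]]) (use bounds t in auto)
  qed
  have H_lim: "(\<lambda>j. H (w j) s) \<longlonglongrightarrow> H v s" if "s \<in> {0..R}" for s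
    unfolding H_def divide_inverse using Kw_lim(2)[OF that] by (intro tendsto_intros)
  \<comment> \<open>The shifted iterates converge both to \<open>v r\<close> and, by dominated
    convergence with the bound from \<open>H_le\<close>, to \<open>F v r\<close>.\<close>
  have v_fix: "v r = F v r" if r: "r \<in> {0..R}" for r
  proof (rule LIMSEQ_unique)
    show "(\<lambda>j. w (Suc j) r) \<longlonglongrightarrow> v r"
      using w_lim[OF r] by (rule LIMSEQ_Suc)
    have "(\<lambda>j. integral {0..r} (H (w j))) \<longlonglongrightarrow> integral {0..r} (H v)"
    proof (rule dominated_convergence(2)[OF H_int[OF w_adm r]])
      show "(\<lambda>t. \<Lambda> * exp (\<Lambda> * t)) integrable_on {0..r}"
        by (intro integrable_continuous_real continuous_intros)
      show "norm (H (w j) t) \<le> \<Lambda> * exp (\<Lambda> * t)" if "t \<in> {0..r}" for j t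
        using H_nonneg[OF w_adm, of t j] H_le[OF w_adm, of t j] that r by auto
      show "(\<lambda>j. H (w j) t) \<longlonglongrightarrow> H v t" if "t \<in> {0..r}" for t
        using H_lim[of t] that r by auto
    qed
    then show "(\<lambda>j. w (Suc j) r) \<longlonglongrightarrow> F v r"
      unfolding w_Suc F_def by (intro tendsto_intros)
  qed
  show ?thesis
  proof (rule that[of "H v" v])
    show "H v s = integral {0..s} (\<lambda>t. K t * v t) / P s" for s
      by (simp add: H_def)
    fix s assume s: "s \<in> {0..R}"
    show "(v has_real_derivative H v s) (at s within {0..R})"
      by (rule has_field_derivative_transform_within[OF F_deriv[OF v_adm s] zero_less_one s])
        (simp add: v_fix)
    show "1 \<le> v s"
      using v_adm s by (simp add: adm_def)
    show "v s \<le> exp (\<Lambda> * R)"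
      using v_adm s exp_le[OF s] unfolding adm_def by (meson order.trans)
    show "0 \<le> H v s"
      by (rule H_nonneg[OF v_adm s])
    show "H v s \<le> \<Lambda> * exp (\<Lambda> * R)"
      using H_le[OF v_adm s] mult_left_mono[OF exp_le[OF s], of \<Lambda>] \<Lambda> by linarith
  qed
qed

section \<open>The homogeneous equation\<close>

text \<open>The factor \<open>sn k r powr - a\<close> carries the whole singularity: what remains is
  a Volterra problem with bounded potential \<open>q\<close>, whose solution \<open>v\<close> lies
  between 1 and a constant. The bounds on \<open>\<phi>\<close> and \<open>\<phi>1\<close> are those
  on \<open>v\<close> and \<open>v'\<close> multiplied back.\<close>

lemma homogeneous_solution:
  fixes n k a \<rho> :: real
  assumes a: "0 \<le> a" "2 * a < n - 2" and \<rho>: "0 < \<rho>"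
  obtains \<phi> \<phi>1 B where
    "0 < B"
    "\<And>r. r \<in> {0<..\<rho>} \<Longrightarrow> (\<phi> has_real_derivative \<phi>1 r) (at r within {0<..\<rho>})"
    "\<And>r. r \<in> {0<..\<rho>} \<Longrightarrow> (\<phi>1 has_real_derivative
        - (n - 1) * (cs k r / sn k r) * \<phi>1 r - a * (n - 2 - a) * \<phi> r / r\<^sup>2) (at r within {0<..\<rho>})"
    "\<And>r. r \<in> {0<..\<rho>} \<Longrightarrow> sn k r powr - a \<le> \<phi> r"
    "\<And>r. r \<in> {0<..\<rho>} \<Longrightarrow> \<phi> r \<le> B * sn k r powr - a"
    "\<And>r. r \<in> {0<..\<rho>} \<Longrightarrow> \<bar>\<phi>1 r\<bar> \<le> B * sn k r powr (- a - 1)"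
proof -
  define \<mu> where "\<mu> = a * (n - 2 - a)"
  have \<mu>: "0 \<le> \<mu>"
    using a by (simp add: \<mu>_def)
  \<comment> \<open>The first derivative term of the equation for \<open>v\<close> has coefficient
    \<open>b * x\<close>, hence the weight \<open>P\<close> with exponent \<open>b\<close>;
    positivity of \<open>b\<close> makes \<open>P\<close> increasing with
    \<open>P 0 = 0\<close>.\<close>
  define b where "b = n - 1 - 2 * a"
  have b: "1 < b"
    using a by (simp add: b_def)
  define x where "x r = cs k r / sn k r" for r
  \<comment> \<open>Substituting \<open>S powr - a * v\<close> and using
    \<open>x' = k\<^sup>2 - x\<^sup>2\<close> gives \<open>v'' + b x v' = q v\<close>. The
    coefficient of \<open>x\<^sup>2\<close> is exactly \<open>\<mu>\<close> because
    \<open>\<mu> = a (n - 2 - a)\<close>, so the inverse square singularities cancel.\<close>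
  define q where "q r = \<mu> * ((x r)\<^sup>2 - 1 / r\<^sup>2) + a * k\<^sup>2" for r
  define P where "P r = sn k r powr b" for r
  \<comment> \<open>The summand 1 keeps \<open>\<Lambda>\<close> positive when \<open>k = 0\<close>
    and makes its square dominate \<open>(\<mu> + a) * k\<^sup>2\<close>.\<close>
  define \<Lambda> where "\<Lambda> = 1 + (\<mu> + a) * k\<^sup>2"
  have \<Lambda>: "0 < \<Lambda>" "(\<mu> + a) * k\<^sup>2 \<le> \<Lambda>\<^sup>2"
  proof -
    have "0 \<le> (\<mu> + a) * k\<^sup>2"
      using \<mu> a by simp
    then show "0 < \<Lambda>" "(\<mu> + a) * k\<^sup>2 \<le> \<Lambda>\<^sup>2"
      using self_le_power[of \<Lambda> 2] by (simp_all add: \<Lambda>_def)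
  qed
  have sn: "0 < sn k r" if "0 < r" for r
    using that by (rule sn_pos)
  have x: "((\<lambda>r. cs k r / sn k r) has_real_derivative k\<^sup>2 - (x r)\<^sup>2) (at r within A)" if "0 < r" for r A
    using sn[OF that]
    by (auto intro!: derivative_eq_intros simp: x_def power_divide field_simps power2_eq_square)
  have x_sq: "(x r)\<^sup>2 = 1 / (sn k r)\<^sup>2 + k\<^sup>2" if "0 < r" for r
    using sn[OF that] by (simp add: x_def power_divide cs_squared field_simps)
  \<comment> \<open>Below, \<open>x r\<close> is at least \<open>1 / r\<close>; above,
    \<open>(x r)\<^sup>2 - 1 / r\<^sup>2\<close> is at most \<open>k\<^sup>2\<close> because
    \<open>sn k r\<close> is at least \<open>r\<close>.\<close>
  have q: "0 \<le> q r" "q r \<le> \<Lambda>\<^sup>2" if r: "0 < r" for r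
  proof -
    have "(1 / r)\<^sup>2 \<le> (x r)\<^sup>2"
      unfolding x_def using cs_div_sn_ge[OF r, of k] r by (intro power_mono) auto
    then show "0 \<le> q r"
      using \<mu> a by (simp add: q_def power_divide)
    have "1 / (sn k r)\<^sup>2 \<le> 1 / r\<^sup>2"
      using sn_ge[of r k] r by (intro divide_left_mono power_mono) (auto simp: sn)
    then have "\<mu> * ((x r)\<^sup>2 - 1 / r\<^sup>2) \<le> \<mu> * k\<^sup>2"
      using \<mu> by (intro mult_left_mono) (auto simp: x_sq[OF r])
    then show "q r \<le> \<Lambda>\<^sup>2"
      using \<Lambda>(2) by (simp add: q_def algebra_simps)
  qed
  have P_pos: "0 < P r" if "0 < r" for r
    using sn[OF that] by (simp add: P_def)
  have P_mono: "P s \<le> P t" if "0 \<le> s" "s \<le> t" for s t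
    unfolding P_def using that b by (intro powr_mono2 sn_mono sn_nonneg) auto
  have P_cont: "continuous_on {0..\<rho>} P"
    unfolding P_def using b by (intro continuous_on_powr' continuous_intros) (auto intro: sn_nonneg)
  \<comment> \<open>The potential need not be examined in the limit at 0: it is bounded and
    \<open>P\<close> vanishes there.\<close>
  have K_cont: "continuous_on {0..\<rho>} (\<lambda>t. P t * q t)"
  proof (rule continuous_on_extend_zero)
    have "continuous_on {0<..\<rho>} x"
      unfolding x_def using x by (intro DERIV_continuous_on) auto
    then show "continuous_on {0<..\<rho>} (\<lambda>t. P t * q t)"
      unfolding q_def
      by (intro continuous_intros continuous_on_subset[OF P_cont]) auto
    show "continuous_on {0..\<rho>} (\<lambda>t. P t * \<Lambda>\<^sup>2)"
      by (intro continuous_intros P_cont)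
    show "\<bar>P t * q t\<bar> \<le> P t * \<Lambda>\<^sup>2" if "0 < t" "t \<le> \<rho>" for t
      using q[of t] P_pos[of t] that by (simp add: abs_mult)
  qed (simp_all add: P_def)
  have K_nonneg: "0 \<le> P t * q t" if "t \<in> {0..\<rho>}" for t
    using q(1)[of t] P_pos[of t] that by (cases "t = 0") (auto simp: P_def)
  have K_le: "P t * q t \<le> \<Lambda>\<^sup>2 * P t" if "t \<in> {0..\<rho>}" for t
    using q(2)[of t] P_pos[of t] that by (cases "t = 0") (auto simp: P_def)
  obtain v h where h: "\<And>s. h s = integral {0..s} (\<lambda>t. P t * q t * v t) / P s"
    and v: "\<And>s. s \<in> {0..\<rho>} \<Longrightarrow> (v has_real_derivative h s) (at s within {0..\<rho>})"
    and v_ge: "\<And>s. s \<in> {0..\<rho>} \<Longrightarrow> 1 \<le> v s"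
    and v_le: "\<And>s. s \<in> {0..\<rho>} \<Longrightarrow> v s \<le> exp (\<Lambda> * \<rho>)"
    and h_ge: "\<And>s. s \<in> {0..\<rho>} \<Longrightarrow> 0 \<le> h s"
    and h_le: "\<And>s. s \<in> {0..\<rho>} \<Longrightarrow> h s \<le> \<Lambda> * exp (\<Lambda> * \<rho>)"
    by (rule volterra_solution[OF \<rho> \<Lambda>(1) P_cont P_mono P_pos K_cont K_nonneg K_le];
        (assumption | (rule that; assumption)))
  have Kv_cont: "continuous_on {0..\<rho>} (\<lambda>t. P t * q t * v t)"
    by (intro continuous_on_mult K_cont DERIV_continuous_on[OF v])
  have P_deriv: "(P has_real_derivative P r * b * x r) (at r within A)" if "0 < r" for r A
    unfolding P_def using sn[OF that]
    by (auto intro!: derivative_eq_intros simp: x_def powr_diff field_simps)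
  \<comment> \<open>This is \<open>(P v')' = P q v\<close> for \<open>h = v'\<close>, with the
    derivative of the weight moved to the right.\<close>
  have h_deriv: "(h has_real_derivative q r * v r - b * x r * h r) (at r within {0..\<rho>})"
    if r: "r \<in> {0<..\<rho>}" for r
  proof -
    have "((\<lambda>s. integral {0..s} (\<lambda>t. P t * q t * v t) / P s) has_real_derivative
        ((P r * q r * v r) * P r - integral {0..r} (\<lambda>t. P t * q t * v t) * (P r * b * x r)) / (P r * P r))
      (at r within {0..\<rho>})"
      using r P_pos[of r]
      by (intro DERIV_divide integral_has_real_derivative[OF Kv_cont] P_deriv) auto
    also have "((P r * q r * v r) * P r - integral {0..r} (\<lambda>t. P t * q t * v t) * (P r * b * x r)) / (P r * P r)
        = q r * v r - b * x r * h r"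
      using r P_pos[of r] by (simp add: h field_simps)
    finally show ?thesis
      by (simp add: h[abs_def])
  qed
  define \<phi> where "\<phi> r = sn k r powr - a * v r" for r
  define \<phi>1 where "\<phi>1 r = sn k r powr - a * (h r - a * (cs k r / sn k r) * v r)" for r
  have S_deriv: "((\<lambda>r. sn k r powr - a) has_real_derivative - a * x r * sn k r powr - a) (at r within A)"
    if "0 < r" for r A
    using sn[OF that] by (auto intro!: derivative_eq_intros simp: x_def powr_diff field_simps)
  have sub: "{0<..\<rho>} \<subseteq> {0..\<rho>}" by auto
  \<comment> \<open>The summands in the bracket bound \<open>v\<close>, \<open>h * sn k r\<close>
    and \<open>a * cs k r * v\<close>, in this order, after the common factor
    \<open>exp (\<Lambda> * \<rho>)\<close>.\<close>
  define B where "B = exp (\<Lambda> * \<rho>) * (1 + \<Lambda> * sn k \<rho> + a * cs k \<rho>)"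
  have B1: "exp (\<Lambda> * \<rho>) \<le> B"
    using \<Lambda> sn[OF \<rho>] a order.trans[OF zero_le_one cs_ge_1[of k \<rho>]] by (simp add: B_def)
  show ?thesis
  proof (rule that[of B \<phi> \<phi>1])
    show "0 < B"
      using B1 by (rule less_le_trans[rotated]) simp
    fix r assume r: "r \<in> {0<..\<rho>}"
    then have r0: "0 < r" and r': "r \<in> {0..\<rho>}" by auto
    have v': "(v has_real_derivative h r) (at r within {0<..\<rho>})"
      using v[OF r'] sub by (rule DERIV_subset)
    have h': "(h has_real_derivative q r * v r - b * x r * h r) (at r within {0<..\<rho>})"
      using h_deriv[OF r] sub by (rule DERIV_subset)
    show "(\<phi> has_real_derivative \<phi>1 r) (at r within {0<..\<rho>})"
      unfolding \<phi>_def[abs_def]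
      by (rule DERIV_cong[OF DERIV_mult[OF S_deriv[OF r0] v']]) (simp add: \<phi>1_def x_def algebra_simps)
    have "(\<phi>1 has_real_derivative - a * x r * sn k r powr - a * (h r - a * (cs k r / sn k r) * v r) +
        (q r * v r - b * x r * h r - (a * (k\<^sup>2 - (x r)\<^sup>2) * v r + h r * (a * (cs k r / sn k r)))) * sn k r powr - a)
        (at r within {0<..\<rho>})"
      unfolding \<phi>1_def[abs_def]
      by (intro DERIV_mult[OF S_deriv[OF r0]] DERIV_diff h' DERIV_mult[OF DERIV_cmult[OF x[OF r0]] v'])
    also have "- a * x r * sn k r powr - a * (h r - a * (cs k r / sn k r) * v r) +
        (q r * v r - b * x r * h r - (a * (k\<^sup>2 - (x r)\<^sup>2) * v r + h r * (a * (cs k r / sn k r)))) * sn k r powr - a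
      = - (n - 1) * (cs k r / sn k r) * \<phi>1 r - a * (n - 2 - a) * \<phi> r / r\<^sup>2"
      unfolding \<phi>_def \<phi>1_def x_def[symmetric] q_def b_def \<mu>_def 
      by (simp add: algebra_simps power2_eq_square add_divide_distrib diff_divide_distrib)
    finally show "(\<phi>1 has_real_derivative
        - (n - 1) * (cs k r / sn k r) * \<phi>1 r - a * (n - 2 - a) * \<phi> r / r\<^sup>2) (at r within {0<..\<rho>})" .
    show "sn k r powr - a \<le> \<phi> r"
      using mult_left_mono[OF v_ge[OF r'], of "sn k r powr - a"] by (simp add: \<phi>_def)
    have "v r \<le> B"
      using v_le[OF r'] B1 by simp
    then show "\<phi> r \<le> B * sn k r powr - a"
      by (simp add: \<phi>_def mult.commute mult_right_mono)
    have "\<bar>h r - a * (cs k r / sn k r) * v r\<bar> \<le> h r + a * (cs k r / sn k r) * v r"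
      using h_ge[OF r'] a v_ge[OF r'] sn[OF r0] cs_ge_1[of k r] by (auto simp: abs_if)
    also have "\<dots> \<le> B / sn k r"
    proof -
      have "h r * sn k r \<le> (\<Lambda> * exp (\<Lambda> * \<rho>)) * sn k \<rho>"
        using h_le[OF r'] h_ge[OF r'] sn[OF r0] \<Lambda> r by (intro mult_mono sn_mono) auto
      moreover have "a * cs k r * v r \<le> a * cs k \<rho> * exp (\<Lambda> * \<rho>)"
        using v_le[OF r'] v_ge[OF r'] a r cs_ge_1[of k \<rho>]
        by (intro mult_mono mult_left_mono cs_mono) auto
      ultimately have "h r * sn k r + a * cs k r * v r \<le> B"
        by (simp add: B_def algebra_simps add_increasing)
      from divide_right_mono[OF this, of "sn k r"] show ?thesis
        using sn[OF r0] by (simp add: add_divide_distrib)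
    qed
    finally have "sn k r powr - a * \<bar>h r - a * (cs k r / sn k r) * v r\<bar> \<le> sn k r powr - a * (B / sn k r)"
      by (rule mult_left_mono) simp
    then show "\<bar>\<phi>1 r\<bar> \<le> B * sn k r powr (- a - 1)"
      using sn[OF r0] by (simp add: \<phi>1_def abs_mult powr_diff mult_ac)
  qed
qed

section \<open>Calculus on the half-open interval\<close>

lemma at_within_pos_interval:
  fixes r e \<rho> :: real
  assumes "0 < e" "e < r"
  shows "at r within {0<..\<rho>} = at r within {e..\<rho>}"
  by (rule at_within_nhd[of r "{e<..}"]) (use assms in auto)

text \<open>At interior points the derivative within the interval is two-sided, so the mean value
  argument applies; at the right end point continuity suffices.\<close>

lemma antimono_on_if_deriv_nonpos:
  fixes f f' :: "real \<Rightarrow> real"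
  assumes f: "\<And>r. r \<in> {0<..\<rho>} \<Longrightarrow> (f has_real_derivative f' r) (at r within {0<..\<rho>})"
    and f': "\<And>r. r \<in> {0<..\<rho>} \<Longrightarrow> f' r \<le> 0"
  shows "antimono_on {0<..\<rho>} f"
proof (rule monotone_onI)
  fix r s assume rs: "r \<in> {0<..\<rho>}" "s \<in> {0<..\<rho>}" "r \<le> s"
  have "\<exists>y. DERIV f t :> y \<and> y \<le> 0" if t: "r < t" "t < s" for t
  proof -
    have "at t within {0<..\<rho>} = at t"
      by (rule at_within_open_subset[of _ "{r<..<s}"]) (use t rs in auto)
    then show ?thesis
      using f[of t] f'[of t] t rs by auto
  qed
  moreover have "continuous_on {r..s} f"
    by (rule continuous_on_subset[OF DERIV_continuous_on[OF f]]) (use rs in auto)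
  ultimately show "f s \<le> f r"
    using DERIV_nonpos_imp_decreasing_open[of r s f] rs by (cases "r = s") auto
qed

section \<open>Finite and infinite energy\<close>

text \<open>The energy density is dominated by a multiple of \<open>r powr e\<close> with
  \<open>e = n - 3 - 2 a\<close>, and \<open>2 a < n - 2\<close> says precisely that
  \<open>e > -1\<close>.\<close>

lemma energy_finite:
  fixes f' :: "real \<Rightarrow> real"
  assumes "0 < \<rho>" and n: "1 \<le> n" and a: "2 * a < real n - 2"
    and le: "\<And>r. r \<in> {0<..\<rho>} \<Longrightarrow> \<bar>f' r\<bar> \<le> D * r powr (- a - 1)"
  shows "(\<integral>\<^sup>+r\<in>{0<..\<rho>}. ennreal ((f' r)\<^sup>2 * r ^ (n - 1)) \<partial>lborel) < \<infinity>"
proof -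
  define e where "e = real n - 3 - 2 * a"
  have "(f' r)\<^sup>2 * r ^ (n - 1) \<le> D\<^sup>2 * r powr e" if r: "r \<in> {0<..\<rho>}" for r
  proof -
    have "(f' r)\<^sup>2 \<le> (D * r powr (- a - 1))\<^sup>2"
      using le[OF r] by (metis abs_ge_zero power2_abs power_mono)
    then have "(f' r)\<^sup>2 * r ^ (n - 1) \<le> (D * r powr (- a - 1))\<^sup>2 * r powr real (n - 1)"
      using r by (simp add: powr_realpow mult_right_mono)
    also have "(D * r powr (- a - 1))\<^sup>2 * r powr real (n - 1) = D\<^sup>2 * (r powr (- a - 1) * r powr (- a - 1) * r powr real (n - 1))"
      by (simp add: power2_eq_square)
    also have "r powr (- a - 1) * r powr (- a - 1) * r powr real (n - 1) = r powr e"
      using r n by (simp add: powr_add[symmetric] e_def of_nat_diff algebra_simps)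
    finally show ?thesis .
  qed
  then have "(\<integral>\<^sup>+r\<in>{0<..\<rho>}. ennreal ((f' r)\<^sup>2 * r ^ (n - 1)) \<partial>lborel)
      \<le> (\<integral>\<^sup>+r. ennreal (indicator {0..\<rho>} r * (D\<^sup>2 * r powr e)) \<partial>lborel)"
    by (intro nn_integral_mono) (auto simp: indicator_def intro: ennreal_leI)
  also have "\<dots> = ennreal (D\<^sup>2 * (\<rho> powr (e + 1) / (e + 1)))"
    using assms by (intro nn_integral_has_integral_lebesgue has_integral_mult_right has_integral_powr_from_0)
      (auto simp: e_def)
  finally show ?thesis
    by (simp add: order.strict_trans1)
qed

text \<open>Logarithmic divergence of the integral of \<open>D / r\<close> at 0.\<close>

lemma energy_infinite:
  fixes F :: "real \<Rightarrow> real"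
  assumes \<rho>: "0 < \<rho>" and D: "0 < D"
    and ge: "\<And>r. r \<in> {0<..\<rho>} \<Longrightarrow> D / r \<le> F r"
  shows "(\<integral>\<^sup>+r\<in>{0<..\<rho>}. ennreal (F r) \<partial>lborel) = \<infinity>"
proof (rule ccontr)
  assume "(\<integral>\<^sup>+r\<in>{0<..\<rho>}. ennreal (F r) \<partial>lborel) \<noteq> \<infinity>"
  then obtain E where E: "0 \<le> E" "(\<integral>\<^sup>+r\<in>{0<..\<rho>}. ennreal (F r) \<partial>lborel) = ennreal E"
    by (cases "\<integral>\<^sup>+r\<in>{0<..\<rho>}. ennreal (F r) \<partial>lborel") auto
  \<comment> \<open>Chosen so that the integral of \<open>D / r\<close> over
    \<open>{e..\<rho>}\<close> equals \<open>E + 1\<close>, exceeding the supposed total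
    \<open>E\<close>.\<close>
  define e where "e = \<rho> * exp (- ((E + 1) / D))"
  have e: "0 < e" "e \<le> \<rho>"
    using \<rho> D E by (auto simp: e_def)
  have "(\<integral>\<^sup>+r. ennreal (D / r) * indicator {e..\<rho>} r \<partial>lborel) = ennreal (D * ln \<rho> - D * ln e)"
  proof (rule nn_integral_FTC_Icc)
    fix r assume r: "r \<in> {e..\<rho>}"
    show "((\<lambda>r. D * ln r) has_real_derivative D / r) (at r)"
      using r e by (auto intro!: derivative_eq_intros)
    show "0 \<le> D / r"
      using r e D by auto
  qed (use e in auto)
  moreover have "(\<integral>\<^sup>+r. ennreal (D / r) * indicator {e..\<rho>} r \<partial>lborel)
      \<le> (\<integral>\<^sup>+r\<in>{0<..\<rho>}. ennreal (F r) \<partial>lborel)"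
    using ge e by (intro nn_integral_mono) (auto simp: indicator_def intro: ennreal_leI)
  moreover have "D * ln \<rho> - D * ln e = E + 1"
    using \<rho> D by (simp add: e_def ln_mult right_diff_distrib)
  ultimately show False
    using E by (simp add: ennreal_le_iff)
qed

section \<open>Uniqueness and the explicit solution\<close>

text \<open>Fixes one homogeneous solution with the bounds supplied by
  \<open>homogeneous_solution\<close>; everything up to uniqueness uses it only through these
  properties.\<close>

locale homogeneous_profile =
  fixes n :: nat and k a \<rho> B :: real and \<phi> \<phi>1 :: "real \<Rightarrow> real"
  assumes n: "3 \<le> n" and a: "0 \<le> a" "2 * a < real n - 2" and \<rho>: "0 < \<rho>"
    and B: "0 < B"
    and \<phi>_deriv: "\<And>r. r \<in> {0<..\<rho>} \<Longrightarrow> (\<phi> has_real_derivative \<phi>1 r) (at r within {0<..\<rho>})"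
    and \<phi>1_deriv: "\<And>r. r \<in> {0<..\<rho>} \<Longrightarrow> (\<phi>1 has_real_derivative
        - (real n - 1) * (cs k r / sn k r) * \<phi>1 r - a * (real n - 2 - a) * \<phi> r / r\<^sup>2) (at r within {0<..\<rho>})"
    and \<phi>_ge: "\<And>r. r \<in> {0<..\<rho>} \<Longrightarrow> sn k r powr - a \<le> \<phi> r"
    and \<phi>_le: "\<And>r. r \<in> {0<..\<rho>} \<Longrightarrow> \<phi> r \<le> B * sn k r powr - a"
    and \<phi>1_le: "\<And>r. r \<in> {0<..\<rho>} \<Longrightarrow> \<bar>\<phi>1 r\<bar> \<le> B * sn k r powr (- a - 1)"
begin

abbreviation S :: "real \<Rightarrow> real" where "S \<equiv> sn k"

lemma S_pos: "r \<in> {0<..\<rho>} \<Longrightarrow> 0 < S r"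
  by (simp add: sn_pos)

lemma \<phi>_pos: "r \<in> {0<..\<rho>} \<Longrightarrow> 0 < \<phi> r"
  using \<phi>_ge[of r] S_pos[of r] powr_gt_zero[of "S r" "- a"] by linarith

lemma S_power: "r \<in> {0<..\<rho>} \<Longrightarrow> S r ^ (n - 1) = S r powr (real n - 1)"
  using S_pos[of r] n by (simp add: powr_realpow[symmetric] of_nat_diff)

lemma density_le:
  assumes r: "r \<in> {0<..\<rho>}"
  shows "S r ^ (n - 1) * \<phi> r \<le> B * S r powr (real n - 1 - a)"
proof -
  have "S r ^ (n - 1) * \<phi> r \<le> S r ^ (n - 1) * (B * S r powr - a)"
    using S_pos[OF r] \<phi>_le[OF r] by (intro mult_left_mono) auto
  also have "\<dots> = B * S r powr (real n - 1 + - a)"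
    unfolding S_power[OF r] mult.left_commute[of _ B] powr_add[symmetric] ..
  finally show ?thesis
    by simp
qed

text \<open>The power \<open>S r ^ (n - 1)\<close> is the integrating factor of the equation: its
  logarithmic derivative is \<open>(n - 1) * cs k r / S r\<close>.\<close>

lemma weighted_deriv:
  assumes "(g has_real_derivative d) (at r within A)" and "0 < r"
  shows "((\<lambda>r. S r ^ (n - 1) * g r) has_real_derivative
    S r ^ (n - 1) * (d + (real n - 1) * (cs k r / S r) * g r)) (at r within A)"
proof -
  \<comment> \<open>This form makes \<open>n - 1\<close> a successor, so that the power rule leaves
    the exponent \<open>m\<close> without truncated subtraction.\<close>
  obtain m where m: "n = Suc (Suc m)"
    using n by (intro that[of "n - 2"]) simp
  define y where "y = cs k r / S r"
  have y: "cs k r = y * S r"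
    using sn_pos[OF \<open>0 < r\<close>, of k] by (simp add: y_def)
  show ?thesis
    unfolding y_def[symmetric]
    by (rule DERIV_cong[OF DERIV_mult[OF DERIV_power[OF has_real_derivative_sn[OF DERIV_ident]] assms(1)]])
      (simp add: m y algebra_simps)
qed

text \<open>The flux \<open>N = S ^ (n - 1) * \<phi>1\<close> is non-increasing by the equation and
  is bounded above by a quantity tending to 0 at 0; hence it is never positive.\<close>

lemma \<phi>1_nonpos:
  assumes r: "r \<in> {0<..\<rho>}"
  shows "\<phi>1 r \<le> 0"
proof -
  define N where "N r = S r ^ (n - 1) * \<phi>1 r" for r
  have cancel: "- p * x * y - z + p * x * y = - z" for p x y z :: real
    by simp
  have "antimono_on {0<..\<rho>} N"
  proof (rule antimono_on_if_deriv_nonpos)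
    fix r assume r: "r \<in> {0<..\<rho>}"
    show "(N has_real_derivative S r ^ (n - 1) * (- (a * (real n - 2 - a) * \<phi> r / r\<^sup>2))) (at r within {0<..\<rho>})"
      unfolding N_def[abs_def]
      using r by (intro DERIV_cong[OF weighted_deriv[OF \<phi>1_deriv[OF r]]]) (simp_all only: cancel, simp)
    have "0 \<le> S r ^ (n - 1) * (a * (real n - 2 - a) * \<phi> r / r\<^sup>2)"
      using a \<phi>_pos[OF r] S_pos[OF r] by simp
    then show "S r ^ (n - 1) * (- (a * (real n - 2 - a) * \<phi> r / r\<^sup>2)) \<le> 0"
      by simp
  qed
  then have ge: "N r \<le> N s" if "0 < s" "s \<le> r" for s
    using monotone_onD[of "{0<..\<rho>}" "(\<le>)" "(\<ge>)" N s r] r that by auto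
  have N_le: "N s \<le> B * S s powr (real n - 2 - a)" if s: "s \<in> {0<..\<rho>}" for s
  proof -
    have "N s \<le> S s ^ (n - 1) * (B * S s powr (- a - 1))"
      unfolding N_def using \<phi>1_le[OF s] S_pos[OF s] by (intro mult_left_mono) auto
    also have "\<dots> = B * S s powr (real n - 2 - a)"
    proof -
      have "real n - 1 + (- a - 1) = real n - 2 - a"
        by simp
      then show ?thesis
        unfolding S_power[OF s] mult.left_commute[of _ B] powr_add[symmetric] by (simp only:)
    qed
    finally show ?thesis .
  qed
  \<comment> \<open>The exponent \<open>n - 2 - a\<close> is positive since \<open>0 \<le> a\<close>
    and \<open>2 a < n - 2\<close>, so the bound vanishes at 0.\<close>
  have "continuous_on {0..\<rho>} (\<lambda>s. B * S s powr (real n - 2 - a))"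
    using a by (intro continuous_intros continuous_on_powr') (auto intro: sn_nonneg)
  then have "((\<lambda>s. B * S s powr (real n - 2 - a)) \<longlongrightarrow> B * S 0 powr (real n - 2 - a)) (at 0 within {0..\<rho>})"
    unfolding continuous_on_def by (rule bspec) (use \<rho> in simp)
  then have "((\<lambda>s. B * S s powr (real n - 2 - a)) \<longlongrightarrow> 0) (at 0 within {0..\<rho>})"
    by simp
  then have lim: "((\<lambda>s. B * S s powr (real n - 2 - a)) \<longlongrightarrow> 0) (at 0 within {0<..r})"
    by (rule tendsto_within_subset) (use r in auto)
  have "N r \<le> 0"
  proof (rule tendsto_lowerbound[OF lim])
    show "eventually (\<lambda>s. N r \<le> B * S s powr (real n - 2 - a)) (at 0 within {0<..r})"
      unfolding eventually_at_filter
      by (rule always_eventually) (use ge N_le r in \<open>auto intro: order.trans\<close>)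
    show "at 0 within {0<..r} \<noteq> bot"
    proof -
      have "at 0 within {0<..r} = at_right 0"
        by (rule at_within_nhd[of 0 "{..<r}"]) (use r in auto)
      then show ?thesis
        by simp
    qed
  qed
  then show ?thesis
    using zero_less_power[OF S_pos[OF r], of "n - 1"] by (auto simp: N_def mult_le_0_iff)
qed

text \<open>If the weighted Wronskian \<open>L\<close> with \<open>\<phi>\<close> is zero,
  \<open>g / \<phi>\<close> is constant and the boundary value decides. Otherwise \<open>g\<close>
  and \<open>L\<close> have opposite signs, and the sign of \<open>\<phi>1\<close> turns the
  Wronskian identity into a lower bound on \<open>g1\<close> that is too large for finite
  energy.\<close>

lemma homogeneous_unique:
  assumes g: "\<And>r. r \<in> {0<..\<rho>} \<Longrightarrow> (g has_real_derivative g1 r) (at r within {0<..\<rho>})"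
    and g1: "\<And>r. r \<in> {0<..\<rho>} \<Longrightarrow> (g1 has_real_derivative
        - (real n - 1) * (cs k r / S r) * g1 r - a * (real n - 2 - a) * g r / r\<^sup>2) (at r within {0<..\<rho>})"
    and "g \<rho> = 0"
    and energy: "(\<integral>\<^sup>+r\<in>{0<..\<rho>}. ennreal ((g1 r)\<^sup>2 * r ^ (n - 1)) \<partial>lborel) < \<infinity>"
    and r: "r \<in> {0<..\<rho>}"
  shows "g r = 0"
proof -
  define A where "A r = S r ^ (n - 1) * (g1 r * \<phi> r - g r * \<phi>1 r)" for r
  define L where "L = A \<rho>"
  define m where "m r = S r ^ (n - 1) * (\<phi> r)\<^sup>2" for r
  have m: "0 < m r" if "r \<in> {0<..\<rho>}" for r
    using S_pos[OF that] \<phi>_pos[OF that] by (simp add: m_def)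
  have cancel: "(- p * x * y - M * u / z) * v + w * y - (y * w + (- p * x * w - M * v / z) * u)
      + p * x * (y * v - u * w) = 0" for p x y z u v w M :: real
    by (simp add: algebra_simps)
  have "(A has_real_derivative 0) (at r within {0<..\<rho>})" if r: "r \<in> {0<..\<rho>}" for r
    unfolding A_def[abs_def]
    using r by (intro DERIV_cong[OF weighted_deriv[OF DERIV_diff[OF DERIV_mult[OF g1[OF r] \<phi>_deriv[OF r]]
          DERIV_mult[OF g[OF r] \<phi>1_deriv[OF r]]]]]) (simp_all only: cancel, simp_all)
  then obtain l where l: "\<And>r. r \<in> {0<..\<rho>} \<Longrightarrow> A r = l"
    using has_field_derivative_zero_constant[of "{0<..\<rho>}" A] by auto
  have A: "A r = L" if "r \<in> {0<..\<rho>}" for r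
    using l[OF that] l[of \<rho>] \<rho> by (simp add: L_def)
  have u_deriv: "((\<lambda>r. g r / \<phi> r) has_real_derivative L / m r) (at r within {0<..\<rho>})" if r: "r \<in> {0<..\<rho>}" for r
  proof -
    have "(g1 r * \<phi> r - g r * \<phi>1 r) / (\<phi> r * \<phi> r) = A r / m r"
      unfolding A_def m_def power2_eq_square
      by (rule nonzero_mult_divide_mult_cancel_left[symmetric]) (use S_pos[OF r] in simp)
    then show ?thesis
      unfolding A[OF r] using DERIV_divide[OF g[OF r] \<phi>_deriv[OF r]] \<phi>_pos[OF r]
      by (metis less_irrefl)
  qed
  show ?thesis
  proof (cases "L = 0")
    case True
    obtain l where l: "\<And>r. r \<in> {0<..\<rho>} \<Longrightarrow> g r / \<phi> r = l"
      using has_field_derivative_zero_constant[of "{0<..\<rho>}" "\<lambda>r. g r / \<phi> r"] u_deriv True by auto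
    have "g r / \<phi> r = g \<rho> / \<phi> \<rho>"
      using l[OF r] l[of \<rho>] \<rho> by simp
    then show ?thesis
      using \<open>g \<rho> = 0\<close> \<phi>_pos[OF r] by simp
  next
    case False
    \<comment> \<open>The factor \<open>- L\<close> handles both signs of \<open>L\<close> at once:
      the derivative becomes \<open>- L\<^sup>2 / m\<close>.\<close>
    have anti: "antimono_on {0<..\<rho>} (\<lambda>r. - L * (g r / \<phi> r))"
    proof (rule antimono_on_if_deriv_nonpos)
      fix r assume r: "r \<in> {0<..\<rho>}"
      show "((\<lambda>r. - L * (g r / \<phi> r)) has_real_derivative - L * (L / m r)) (at r within {0<..\<rho>})"
        by (rule DERIV_cmult[OF u_deriv[OF r]])
      show "- L * (L / m r) \<le> 0"
        using m[OF r] by simp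
    qed
    have Lg: "L * g r \<le> 0" if r: "r \<in> {0<..\<rho>}" for r
    proof -
      have "- L * (g \<rho> / \<phi> \<rho>) \<le> - L * (g r / \<phi> r)"
        using monotone_onD[OF anti r, of \<rho>] r by auto
      then show ?thesis
        using \<open>g \<rho> = 0\<close> \<phi>_pos[OF r] by (simp add: divide_le_0_iff)
    qed
    define b where "b = real n - 1 - a"
    have b: "0 \<le> b"
      using a by (simp add: b_def)
    have lower: "\<bar>L\<bar> / (B * (cs k \<rho> powr b * r powr b)) \<le> \<bar>g1 r\<bar>" if r: "r \<in> {0<..\<rho>}" for r
    proof -
      \<comment> \<open>Trades powers of \<open>S r\<close> for powers of \<open>r\<close>, in which
        the energy is expressed.\<close>
      have "S r \<le> r * cs k \<rho>"
        using r by (intro order.trans[OF sn_le] mult_left_mono cs_mono) auto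
      then have "S r powr b \<le> (r * cs k \<rho>) powr b"
        using b S_pos[OF r] by (intro powr_mono2) auto
      also have "\<dots> = cs k \<rho> powr b * r powr b"
        using r order.trans[OF zero_le_one cs_ge_1[of k \<rho>]] by (simp add: powr_mult)
      finally have Sb: "S r powr b \<le> cs k \<rho> powr b * r powr b" .
      have "S r ^ (n - 1) * \<phi> r \<le> B * S r powr b"
        unfolding b_def by (rule density_le[OF r])
      also have "\<dots> \<le> B * (cs k \<rho> powr b * r powr b)"
        using Sb B by simp
      finally have upper: "S r ^ (n - 1) * \<phi> r \<le> B * (cs k \<rho> powr b * r powr b)" .
      have "0 \<le> (L * g r) * \<phi>1 r"
        using Lg[OF r] \<phi>1_nonpos[OF r] by (rule mult_nonpos_nonpos)
      then have "0 \<le> S r ^ (n - 1) * ((L * g r) * \<phi>1 r)"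
        using S_pos[OF r] by simp
      moreover have "L * A r = L * (S r ^ (n - 1) * \<phi> r * g1 r) - S r ^ (n - 1) * ((L * g r) * \<phi>1 r)"
        unfolding A_def by (simp only: right_diff_distrib mult_ac)
      ultimately have "L * L \<le> L * (S r ^ (n - 1) * \<phi> r * g1 r)"
        unfolding A[OF r] by linarith
      also have "\<dots> \<le> \<bar>L\<bar> * (S r ^ (n - 1) * \<phi> r * \<bar>g1 r\<bar>)"
        by (rule ord_le_eq_trans[OF abs_ge_self]) (use S_pos[OF r] \<phi>_pos[OF r] in \<open>simp add: abs_mult\<close>)
      finally have "\<bar>L\<bar> * \<bar>L\<bar> \<le> \<bar>L\<bar> * (S r ^ (n - 1) * \<phi> r * \<bar>g1 r\<bar>)"
        by simp
      then have "\<bar>L\<bar> \<le> S r ^ (n - 1) * \<phi> r * \<bar>g1 r\<bar>"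
        by (rule mult_left_le_imp_le) (use False in simp)
      also have "\<dots> \<le> B * (cs k \<rho> powr b * r powr b) * \<bar>g1 r\<bar>"
        using upper by (rule mult_right_mono) simp
      finally show ?thesis
        using B r order.strict_trans2[OF zero_less_one cs_ge_1[of k \<rho>]]
        by (simp add: field_simps)
    qed
    define q where "q = \<bar>L\<bar> / (B * cs k \<rho> powr b)"
    have q: "0 < q"
      using False B order.strict_trans2[OF zero_less_one cs_ge_1[of k \<rho>]] by (simp add: q_def)
    \<comment> \<open>The density of the lower bound \<open>q * r powr - b\<close> is
      \<open>q\<^sup>2 * r powr (2 + 2 * a - n)\<close> divided by \<open>r\<close>. The exponent is
      negative, so the power is smallest at \<open>\<rho>\<close>.\<close>
    define D where "D = q\<^sup>2 * \<rho> powr (2 + 2 * a - real n)"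
    have "(\<integral>\<^sup>+r\<in>{0<..\<rho>}. ennreal ((g1 r)\<^sup>2 * r ^ (n - 1)) \<partial>lborel) = \<infinity>"
    proof (rule energy_infinite[OF \<rho>])
      show "0 < D"
        using q \<rho> by (simp add: D_def)
      fix r assume r: "r \<in> {0<..\<rho>}"
      have "D \<le> q\<^sup>2 * r powr (2 + 2 * a - real n)"
        unfolding D_def using r a by (intro mult_left_mono powr_mono2') auto
      also have "r powr (2 + 2 * a - real n) = r * (r powr (- b) * r powr (- b) * r powr (real n - 1))"
      proof -
        have "- b + - b + (real n - 1) = 1 + 2 * a - real n" "1 + (1 + 2 * a - real n) = 2 + 2 * a - real n"
          by (simp_all add: b_def)
        then show ?thesis
          using powr_mult_base[of r "1 + 2 * a - real n"] r by (simp only: powr_add[symmetric]) simp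
      qed
      also have "r powr (real n - 1) = r ^ (n - 1)"
        using r n by (simp add: powr_realpow[symmetric] of_nat_diff)
      finally have "D / r \<le> (q * r powr - b)\<^sup>2 * r ^ (n - 1)"
        using r by (simp add: divide_le_eq power2_eq_square mult_ac)
      also have "q * r powr - b = \<bar>L\<bar> / (B * (cs k \<rho> powr b * r powr b))"
        by (simp add: powr_minus_divide q_def)
      also have "(\<bar>L\<bar> / (B * (cs k \<rho> powr b * r powr b)))\<^sup>2 * r ^ (n - 1) \<le> \<bar>g1 r\<bar>\<^sup>2 * r ^ (n - 1)"
        using lower[OF r] B r by (intro mult_right_mono power_mono) auto
      finally show "D / r \<le> (g1 r)\<^sup>2 * r ^ (n - 1)"
        by simp
    qed
    with energy show ?thesis by simp
  qed
qed

section \<open>The particular solution by reduction of order\<close>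

definition G :: "real \<Rightarrow> real" where
  "G s = integral {0..s} (\<lambda>t. S t ^ (n - 1) * \<phi> t)"

text \<open>For \<open>sol = \<phi> * w\<close> the equation reads \<open>(S ^ (n - 1) *
  \<phi>\<^sup>2 * w')' = - S ^ (n - 1) * \<phi>\<close>, so \<open>y\<close> is
  \<open>- w'\<close>. Integrating from 0 in \<open>G\<close> selects the branch of finite
  energy.\<close>

definition y :: "real \<Rightarrow> real" where
  "y s = G s / (S s ^ (n - 1) * (\<phi> s)\<^sup>2)"

definition w :: "real \<Rightarrow> real" where
  "w r = integral {r..\<rho>} y"

definition sol :: "real \<Rightarrow> real" where
  "sol r = \<phi> r * w r"

definition sol1 :: "real \<Rightarrow> real" where
  "sol1 r = \<phi>1 r * w r - \<phi> r * y r"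

lemma density_cont: "continuous_on {0..\<rho>} (\<lambda>t. S t ^ (n - 1) * \<phi> t)"
proof (rule continuous_on_extend_zero)
  show "continuous_on {0<..\<rho>} (\<lambda>t. S t ^ (n - 1) * \<phi> t)"
    by (intro continuous_intros DERIV_continuous_on[OF \<phi>_deriv])
  show "continuous_on {0..\<rho>} (\<lambda>t. B * S t powr (real n - 1 - a))"
    using a by (intro continuous_intros continuous_on_powr') (auto intro: sn_nonneg)
  show "\<bar>S t ^ (n - 1) * \<phi> t\<bar> \<le> B * S t powr (real n - 1 - a)" if "0 < t" "t \<le> \<rho>" for t
    using density_le[of t] S_pos[of t] \<phi>_pos[of t] that by simp
qed (use n in auto)

lemma G_deriv:
  assumes "r \<in> {0<..\<rho>}"
  shows "(G has_real_derivative S r ^ (n - 1) * \<phi> r) (at r within {0<..\<rho>})"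
  unfolding G_def[abs_def]
  by (rule DERIV_subset[OF integral_has_real_derivative[OF density_cont]]) (use assms in auto)

text \<open>The upper bound is \<open>weighted_primitive_bound\<close> with the monotone weight
  \<open>S powr (n - 1 - a)\<close>, which dominates the density up to \<open>B\<close>.\<close>

lemma
  assumes r: "r \<in> {0<..\<rho>}"
  shows G_nonneg: "0 \<le> G r" and G_le: "G r \<le> B * r * S r powr (real n - 1 - a)"
proof -
  have *: "\<bar>S t ^ (n - 1) * \<phi> t\<bar> \<le> B * S t powr (real n - 1 - a)" if "t \<in> {0..\<rho>}" for t
    using density_le[of t] S_pos[of t] \<phi>_pos[of t] that n by (cases "t = 0") auto
  have "\<bar>G r / S r powr (real n - 1 - a)\<bar> \<le> B * r"
    unfolding G_def
  proof (rule weighted_primitive_bound[of _ \<rho>])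
    show "(\<lambda>t. S t ^ (n - 1) * \<phi> t) integrable_on {0..\<rho>}"
      by (rule integrable_continuous_real[OF density_cont])
    show "continuous_on {0..\<rho>} (\<lambda>t. S t powr (real n - 1 - a))"
      using a by (intro continuous_intros continuous_on_powr') (auto intro: sn_nonneg)
    show "S s powr (real n - 1 - a) \<le> S t powr (real n - 1 - a)" if "0 \<le> s" "s \<le> t" for s t
      using that a by (intro powr_mono2 sn_mono sn_nonneg) auto
    show "0 < S t powr (real n - 1 - a)" if "0 < t" "t \<le> \<rho>" for t
      using S_pos[of t] that by simp
  qed (use r B * in auto)
  then show "G r \<le> B * r * S r powr (real n - 1 - a)"
    using S_pos[OF r] by (simp add: field_simps abs_le_iff)
  show "0 \<le> G r"
    unfolding G_def
  proof (rule integral_nonneg)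
    show "(\<lambda>t. S t ^ (n - 1) * \<phi> t) integrable_on {0..r}"
      by (intro integrable_continuous_real continuous_on_subset[OF density_cont]) (use r in auto)
    show "0 \<le> S t ^ (n - 1) * \<phi> t" if "t \<in> {0..r}" for t
      using S_pos[of t] \<phi>_pos[of t] that r n by (cases "t = 0") (auto simp: power_0_left)
  qed
qed

lemma y_nonneg: "r \<in> {0<..\<rho>} \<Longrightarrow> 0 \<le> y r"
  using G_nonneg[of r] S_pos[of r] by (simp add: y_def)

text \<open>One factor \<open>\<phi>\<close> cancels, and the lower bound on the other matches the
  growth of \<open>G\<close>. The estimate controls the second term of \<open>sol1\<close> and,
  through \<open>y_le\<close>, the size of \<open>w\<close>.\<close>

lemma \<phi>_y_le:
  assumes r: "r \<in> {0<..\<rho>}"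
  shows "\<phi> r * y r \<le> B * r"
proof -
  have "S r powr (real n - 1 - a) = S r ^ (n - 1) * S r powr - a"
    unfolding S_power[OF r] powr_add[symmetric] by simp
  also have "\<dots> \<le> S r ^ (n - 1) * \<phi> r"
    using S_pos[OF r] \<phi>_ge[OF r] by (intro mult_left_mono) auto
  finally have "B * r * S r powr (real n - 1 - a) \<le> B * r * (S r ^ (n - 1) * \<phi> r)"
    using B r by (intro mult_left_mono) auto
  with G_le[OF r] have le: "G r \<le> B * r * (S r ^ (n - 1) * \<phi> r)"
    by (rule order.trans)
  have "\<phi> r * y r = G r / (S r ^ (n - 1) * \<phi> r)"
    using \<phi>_pos[OF r] by (simp add: y_def power2_eq_square)
  also have "\<dots> \<le> B * r"
    using le S_pos[OF r] \<phi>_pos[OF r] by (simp add: divide_le_eq)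
  finally show ?thesis .
qed

lemma y_le:
  assumes r: "r \<in> {0<..\<rho>}"
  shows "y r \<le> B * \<rho> * S \<rho> powr a"
proof -
  have "S r powr - a * y r \<le> \<phi> r * y r"
    using \<phi>_ge[OF r] y_nonneg[OF r] by (rule mult_right_mono)
  also have "\<dots> \<le> B * r"
    by (rule \<phi>_y_le[OF r])
  finally have "S r powr a * (S r powr - a * y r) \<le> S r powr a * (B * r)"
    by (rule mult_left_mono) simp
  moreover have "S r powr a * (S r powr - a * y r) = y r"
    using S_pos[OF r] by (simp add: powr_minus)
  moreover have "S r powr a * (B * r) \<le> S \<rho> powr a * (B * \<rho>)"
    using r B a S_pos[OF r] by (intro mult_mono powr_mono2 sn_mono) auto
  ultimately have "y r \<le> S \<rho> powr a * (B * \<rho>)"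
    by linarith
  then show ?thesis
    by (simp only: mult_ac)
qed

text \<open>The quotient rule in logarithmic form: \<open>G'\<close> over the denominator is
  \<open>1 / \<phi>\<close>, and the denominator has logarithmic derivative
  \<open>(n - 1) * cs k / S + 2 * \<phi>1 / \<phi>\<close>.\<close>

lemma y_deriv:
  assumes r: "r \<in> {0<..\<rho>}"
  shows "(y has_real_derivative
    1 / \<phi> r - y r * ((real n - 1) * (cs k r / S r) + 2 * (\<phi>1 r / \<phi> r))) (at r within {0<..\<rho>})"
proof -
  have pos: "0 < S r ^ (n - 1)" "0 < \<phi> r"
    using S_pos[OF r] \<phi>_pos[OF r] by auto
  have sq: "((\<lambda>r. (\<phi> r)\<^sup>2) has_real_derivative 2 * (\<phi> r * \<phi>1 r)) (at r within {0<..\<rho>})"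
    by (auto intro!: derivative_eq_intros \<phi>_deriv[OF r])
  have m: "((\<lambda>r. S r ^ (n - 1) * (\<phi> r)\<^sup>2) has_real_derivative
      S r ^ (n - 1) * (2 * (\<phi> r * \<phi>1 r) + (real n - 1) * (cs k r / S r) * (\<phi> r)\<^sup>2)) (at r within {0<..\<rho>})"
    using r by (intro weighted_deriv[OF sq]) auto
  have alg: "(p * f * (p * f\<^sup>2) - g * (p * (2 * (f * f') + x * f\<^sup>2))) / (p * f\<^sup>2 * (p * f\<^sup>2))
      = 1 / f - g / (p * f\<^sup>2) * (x + 2 * (f' / f))" if "0 < p" "0 < f" for p f f' g x :: real
    using that by (simp add: divide_simps) (simp add: algebra_simps power2_eq_square)
  show ?thesis
    unfolding y_def[abs_def] alg[OF pos, symmetric]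
    by (rule DERIV_divide[OF G_deriv[OF r] m]) (use S_pos[OF r] pos in simp)
qed

lemma y_cont: "continuous_on {0<..\<rho>} y"
  by (rule DERIV_continuous_on[OF y_deriv])

lemma w_deriv:
  assumes r: "r \<in> {0<..\<rho>}"
  shows "(w has_real_derivative - y r) (at r within {0<..\<rho>})"
proof -
  \<comment> \<open>Continuity of \<open>y\<close> is available only away from 0, so the
    neighbourhood is cut off at \<open>r / 2\<close>.\<close>
  have "at r within {0<..\<rho>} = at r within {r / 2..\<rho>}"
    by (rule at_within_pos_interval) (use r in auto)
  moreover have "continuous_on {r / 2..\<rho>} y"
    by (rule continuous_on_subset[OF y_cont]) (use r in auto)
  ultimately show ?thesis
    unfolding w_def[abs_def] using r by (simp add: integral_has_real_derivative')
qed

lemma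
  assumes r: "r \<in> {0<..\<rho>}"
  shows w_nonneg: "0 \<le> w r" and w_le: "w r \<le> B * \<rho> * S \<rho> powr a * \<rho>"
proof -
  have int: "y integrable_on {r..\<rho>}"
    by (intro integrable_continuous_real continuous_on_subset[OF y_cont]) (use r in auto)
  show "0 \<le> w r"
    unfolding w_def by (rule integral_nonneg[OF int]) (use r y_nonneg in auto)
  have "w r \<le> integral {r..\<rho>} (\<lambda>_. B * \<rho> * S \<rho> powr a)"
    unfolding w_def by (rule integral_le[OF int]) (use r y_le in auto)
  also have "\<dots> = B * \<rho> * S \<rho> powr a * (\<rho> - r)"
    using r by simp
  also have "\<dots> \<le> B * \<rho> * S \<rho> powr a * \<rho>"
    using r B by (intro mult_left_mono) auto
  finally show "w r \<le> B * \<rho> * S \<rho> powr a * \<rho>" .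
qed

lemma sol_nonneg: "r \<in> {0<..\<rho>} \<Longrightarrow> 0 \<le> sol r"
  using \<phi>_pos[of r] w_nonneg[of r] by (simp add: sol_def)

lemma sol1_nonpos:
  assumes r: "r \<in> {0<..\<rho>}"
  shows "sol1 r \<le> 0"
proof -
  have "\<phi>1 r * w r \<le> 0" "0 \<le> \<phi> r * y r"
    using \<phi>1_nonpos[OF r] w_nonneg[OF r] \<phi>_pos[OF r] y_nonneg[OF r]
    by (auto simp: mult_le_0_iff)
  then show ?thesis
    by (simp add: sol1_def)
qed

lemma sol_boundary: "sol \<rho> = 0"
  by (simp add: sol_def w_def)

lemma sol_deriv:
  assumes r: "r \<in> {0<..\<rho>}"
  shows "(sol has_real_derivative sol1 r) (at r within {0<..\<rho>})"
  unfolding sol_def[abs_def] sol1_def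
  by (rule DERIV_cong[OF DERIV_mult[OF \<phi>_deriv[OF r] w_deriv[OF r]]]) (simp add: algebra_simps)

text \<open>The terms with \<open>w\<close> reproduce the homogeneous equation of
  \<open>\<phi>\<close>, the terms \<open>\<phi>1 * y\<close> cancel, and \<open>1 / \<phi>\<close>
  from \<open>y_deriv\<close> times \<open>\<phi>\<close> leaves the source.\<close>

lemma sol1_deriv:
  assumes r: "r \<in> {0<..\<rho>}"
  shows "(sol1 has_real_derivative - (real n - 1) * (cs k r / S r) * sol1 r
    - a * (real n - 2 - a) * sol r / r\<^sup>2 - 1) (at r within {0<..\<rho>})"
proof -
  have alg: "(- p * x * f1 - M * f / z) * v + - u * f1 - (f1 * u + (1 / f - u * (p * x + 2 * (f1 / f))) * f)
      = - p * x * (f1 * v - f * u) - M * (f * v) / z - 1" if "0 < f" for p x f f1 M z u v :: real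
    using that by (simp add: algebra_simps)
  show ?thesis
    unfolding sol_def[abs_def] sol1_def alg[OF \<phi>_pos[OF r], symmetric]
    by (intro DERIV_diff DERIV_mult \<phi>1_deriv \<phi>_deriv w_deriv y_deriv r)
qed

lemma sol_energy: "(\<integral>\<^sup>+r\<in>{0<..\<rho>}. ennreal ((sol1 r)\<^sup>2 * r ^ (n - 1)) \<partial>lborel) < \<infinity>"
proof (rule energy_finite[OF \<rho> _ a(2)])
  define M where "M = B * \<rho> * S \<rho> powr a * \<rho>"
  fix r assume r: "r \<in> {0<..\<rho>}"
  have "\<bar>\<phi>1 r * w r\<bar> \<le> (B * S r powr (- a - 1)) * M"
    unfolding abs_mult M_def using \<phi>1_le[OF r] w_le[OF r] w_nonneg[OF r] by (intro mult_mono) auto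
  also have "\<dots> \<le> (B * r powr (- a - 1)) * M"
    using r a B \<rho> sn_ge[of r k] by (intro mult_right_mono mult_left_mono powr_mono2') (auto simp: M_def)
  finally have 1: "\<bar>\<phi>1 r * w r\<bar> \<le> B * r powr (- a - 1) * M" .
  have "\<bar>\<phi> r * y r\<bar> \<le> B * r"
    using \<phi>_y_le[OF r] \<phi>_pos[OF r] y_nonneg[OF r] by simp
  \<comment> \<open>Writing \<open>r\<close> this way gives both terms of \<open>sol1\<close> the
    common growth rate required by \<open>energy_finite\<close>.\<close>
  also have "B * r = B * (r powr (a + 2) * r powr (- a - 1))"
    using r by (simp flip: powr_add)
  also have "\<dots> \<le> B * (\<rho> powr (a + 2) * r powr (- a - 1))"
    using r a B by (intro mult_right_mono mult_left_mono powr_mono2) auto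
  finally have "\<bar>\<phi> r * y r\<bar> \<le> B * (\<rho> powr (a + 2) * r powr (- a - 1))" .
  with 1 show "\<bar>sol1 r\<bar> \<le> (B * M + B * \<rho> powr (a + 2)) * r powr (- a - 1)"
    unfolding sol1_def by (simp add: algebra_simps)
qed (use n in simp)

text \<open>The difference from \<open>sol\<close> solves the homogeneous problem; its energy is
  finite by \<open>(p - q)\<^sup>2 \<le> 2 p\<^sup>2 + 2 q\<^sup>2\<close>.\<close>

lemma sol_unique:
  assumes f: "\<And>r. r \<in> {0<..\<rho>} \<Longrightarrow> (f has_real_derivative f1 r) (at r within {0<..\<rho>})"
    and f1: "\<And>r. r \<in> {0<..\<rho>} \<Longrightarrow> (f1 has_real_derivative f2 r) (at r within {0<..\<rho>})"
    and f2: "\<And>r. r \<in> {0<..\<rho>} \<Longrightarrow>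
      f2 r + (real n - 1) * f1 r * (cs k r / S r) + a * (real n - 2 - a) * (f r / r\<^sup>2) + 1 = 0"
    and "f \<rho> = 0"
    and energy: "(\<integral>\<^sup>+r\<in>{0<..\<rho>}. ennreal ((f1 r)\<^sup>2 * r ^ (n - 1)) \<partial>lborel) < \<infinity>"
    and r: "r \<in> {0<..\<rho>}"
  shows "f r = sol r"
proof -
  have alg: "- p * x * u - M * v / z = d - (- p * x * u0 - M * v0 / z - 1)"
    if "d + p * (u + u0) * x + M * ((v + v0) / z) + 1 = 0" for p x u v u0 v0 M z d :: real
    using that by (simp add: algebra_simps add_divide_distrib)
  have "f r - sol r = 0"
  proof (rule homogeneous_unique[of "\<lambda>r. f r - sol r" "\<lambda>r. f1 r - sol1 r"])
    fix r assume r: "r \<in> {0<..\<rho>}"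
    show "((\<lambda>r. f r - sol r) has_real_derivative f1 r - sol1 r) (at r within {0<..\<rho>})"
      by (intro DERIV_diff f sol_deriv r)
    have "- (real n - 1) * (cs k r / S r) * (f1 r - sol1 r) - a * (real n - 2 - a) * (f r - sol r) / r\<^sup>2
      = f2 r - (- (real n - 1) * (cs k r / S r) * sol1 r - a * (real n - 2 - a) * sol r / r\<^sup>2 - 1)"
      by (rule alg) (use f2[OF r] in simp)
    then show "((\<lambda>r. f1 r - sol1 r) has_real_derivative
      - (real n - 1) * (cs k r / S r) * (f1 r - sol1 r) - a * (real n - 2 - a) * (f r - sol r) / r\<^sup>2)
      (at r within {0<..\<rho>})"
      by (simp only:) (intro DERIV_diff f1 sol1_deriv r)
  next
    \<comment> \<open>Additivity of the integral requires measurable densities; \<open>f1\<close>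
      and \<open>sol1\<close> are continuous on the interval, being differentiable there.\<close>
    have meas: "(\<lambda>r. ennreal ((h r)\<^sup>2 * r ^ (n - 1)) * indicator {0<..\<rho>} r) \<in> borel_measurable lborel"
      if "continuous_on {0<..\<rho>} h" for h
    proof -
      have "continuous_on {0<..\<rho>} (\<lambda>r. (h r)\<^sup>2 * r ^ (n - 1))"
        by (intro continuous_intros that)
      then have "(\<lambda>r. indicator {0<..\<rho>} r *\<^sub>R ((h r)\<^sup>2 * r ^ (n - 1))) \<in> borel_measurable borel"
        by (intro borel_measurable_continuous_on_indicator) auto
      then have "(\<lambda>r. ennreal (indicator {0<..\<rho>} r *\<^sub>R ((h r)\<^sup>2 * r ^ (n - 1)))) \<in> borel_measurable borel"
        by measurable
      also have "(\<lambda>r. ennreal (indicator {0<..\<rho>} r *\<^sub>R ((h r)\<^sup>2 * r ^ (n - 1))))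
          = (\<lambda>r. ennreal ((h r)\<^sup>2 * r ^ (n - 1)) * indicator {0<..\<rho>} r)"
        by (auto simp: indicator_def)
      finally show ?thesis by simp
    qed
    let ?e = "\<lambda>h r. ennreal ((h r)\<^sup>2 * r ^ (n - 1)) * indicator {0<..\<rho>} r"
    have "?e (\<lambda>r. f1 r - sol1 r) r \<le> 2 * ?e f1 r + 2 * ?e sol1 r" for r
    proof (cases "r \<in> {0<..\<rho>}")
      case True
      have "(f1 r - sol1 r)\<^sup>2 \<le> 2 * (f1 r)\<^sup>2 + 2 * (sol1 r)\<^sup>2"
        using zero_le_power2[of "f1 r + sol1 r"] by (simp add: power2_eq_square algebra_simps)
      then have "(f1 r - sol1 r)\<^sup>2 * r ^ (n - 1) \<le> (2 * (f1 r)\<^sup>2 + 2 * (sol1 r)\<^sup>2) * r ^ (n - 1)"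
        using True by (intro mult_right_mono) auto
      then have "ennreal ((f1 r - sol1 r)\<^sup>2 * r ^ (n - 1))
          \<le> ennreal (2 * ((f1 r)\<^sup>2 * r ^ (n - 1)) + 2 * ((sol1 r)\<^sup>2 * r ^ (n - 1)))"
        by (intro ennreal_leI) (simp add: algebra_simps)
      also have "\<dots> = 2 * ennreal ((f1 r)\<^sup>2 * r ^ (n - 1)) + 2 * ennreal ((sol1 r)\<^sup>2 * r ^ (n - 1))"
        using True by (subst ennreal_plus) (auto simp: ennreal_mult')
      finally show ?thesis
        using True by simp
    qed simp
    then have "integral\<^sup>N lborel (?e (\<lambda>r. f1 r - sol1 r)) \<le> (\<integral>\<^sup>+r. 2 * ?e f1 r + 2 * ?e sol1 r \<partial>lborel)"
      by (rule nn_integral_mono)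
    also have "\<dots> = 2 * integral\<^sup>N lborel (?e f1) + 2 * integral\<^sup>N lborel (?e sol1)"
      using meas[OF DERIV_continuous_on[OF f1]] meas[OF DERIV_continuous_on[OF sol1_deriv]]
      by (subst nn_integral_add) (auto simp: nn_integral_cmult)
    also have "\<dots> < \<infinity>"
      using energy sol_energy by (auto simp: ennreal_mult_less_top)
    finally show "integral\<^sup>N lborel (?e (\<lambda>r. f1 r - sol1 r)) < \<infinity>" .
  qed (use r \<open>f \<rho> = 0\<close> sol_boundary in auto)
  then show ?thesis by simp
qed

end

section \<open>Smoothness\<close>

text \<open>The algebra of functions generated by \<open>\<F>\<close> and the constants. If the
  derivatives of the generators stay in it, differentiation can be repeated indefinitely.\<close>

inductive_set ode_algebra :: "(real \<Rightarrow> real) set \<Rightarrow> (real \<Rightarrow> real) set" for \<F> where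
  base: "f \<in> \<F> \<Longrightarrow> f \<in> ode_algebra \<F>"
| const: "(\<lambda>_. x) \<in> ode_algebra \<F>"
| add: "f \<in> ode_algebra \<F> \<Longrightarrow> g \<in> ode_algebra \<F> \<Longrightarrow> (\<lambda>r. f r + g r) \<in> ode_algebra \<F>"
| mult: "f \<in> ode_algebra \<F> \<Longrightarrow> g \<in> ode_algebra \<F> \<Longrightarrow> (\<lambda>r. f r * g r) \<in> ode_algebra \<F>"

lemma ode_algebra_deriv:
  assumes closed: "\<And>f. f \<in> \<F> \<Longrightarrow>
    \<exists>f'\<in>ode_algebra \<F>. \<forall>r\<in>U. (f has_real_derivative f' r) (at r)"
    and "g \<in> ode_algebra \<F>"
  shows "\<exists>g'\<in>ode_algebra \<F>. \<forall>r\<in>U. (g has_real_derivative g' r) (at r)"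
  using assms(2)
proof induction
  case (const x)
  show ?case
    by (rule bexI[of _ "\<lambda>_. 0"]) (auto intro: ode_algebra.const)
next
  case (add f g)
  then obtain f' g' where "f' \<in> ode_algebra \<F>" "g' \<in> ode_algebra \<F>"
    "\<forall>r\<in>U. (f has_real_derivative f' r) (at r)" "\<forall>r\<in>U. (g has_real_derivative g' r) (at r)"
    by blast
  then show ?case
    by (intro bexI[of _ "\<lambda>r. f' r + g' r"]) (auto intro: DERIV_add ode_algebra.add)
next
  case (mult f g)
  then obtain f' g' where "f' \<in> ode_algebra \<F>" "g' \<in> ode_algebra \<F>"
    "\<forall>r\<in>U. (f has_real_derivative f' r) (at r)" "\<forall>r\<in>U. (g has_real_derivative g' r) (at r)"
    by blast
  with mult.hyps show ?case
    by (intro bexI[of _ "\<lambda>r. f' r * g r + g' r * f r"])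
      (auto intro: DERIV_mult ode_algebra.add ode_algebra.mult)
qed (rule closed)

text \<open>By induction every iterated \<open>deriv\<close> agrees on \<open>U\<close> with a
  member of the algebra; since \<open>U\<close> is open, agreement there suffices to differentiate
  once more.\<close>

lemma smooth_on_ode_algebra:
  assumes U: "open U"
    and closed: "\<And>f. f \<in> \<F> \<Longrightarrow>
      \<exists>f'\<in>ode_algebra \<F>. \<forall>r\<in>U. (f has_real_derivative f' r) (at r)"
    and g: "g \<in> ode_algebra \<F>"
  shows "smooth_on U g"
  unfolding smooth_on_def
proof
  fix j
  have "\<exists>h\<in>ode_algebra \<F>. \<forall>r\<in>U. (deriv ^^ j) g r = h r"
  proof (induction j)
    case 0
    show ?case using g by auto
  next
    case (Suc j)
    then obtain h where h: "h \<in> ode_algebra \<F>" "\<And>r. r \<in> U \<Longrightarrow> (deriv ^^ j) g r = h r"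
      by blast
    obtain h' where h': "h' \<in> ode_algebra \<F>" "\<And>r. r \<in> U \<Longrightarrow> (h has_real_derivative h' r) (at r)"
      using ode_algebra_deriv[OF closed h(1)] by blast
    have "(deriv ^^ Suc j) g r = h' r" if r: "r \<in> U" for r
    proof -
      have "((deriv ^^ j) g has_real_derivative h' r) (at r)"
        by (rule has_field_derivative_transform_within_open[OF h'(2)[OF r] U r]) (simp add: h(2))
      then show ?thesis
        by (simp add: DERIV_imp_deriv)
    qed
    with h'(1) show ?case by blast
  qed
  then obtain h where h: "h \<in> ode_algebra \<F>" "\<And>r. r \<in> U \<Longrightarrow> (deriv ^^ j) g r = h r"
    by blast
  obtain h' where h': "\<And>r. r \<in> U \<Longrightarrow> (h has_real_derivative h' r) (at r)"
    using ode_algebra_deriv[OF closed h(1)] by blast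
  have "((deriv ^^ j) g has_real_derivative h' r) (at r)" if r: "r \<in> U" for r
    by (rule has_field_derivative_transform_within_open[OF h'[OF r] U r]) (simp add: h(2))
  then show "(deriv ^^ j) g differentiable_on U"
    by (meson differentiable_at_withinI differentiable_on_def real_differentiable_def)
qed

text \<open>The generators \<open>f\<close>, \<open>f1\<close>, \<open>ct c\<close> and
  \<open>1 / r\<close> are closed under differentiation: the equation itself gives
  \<open>f1'\<close>, and \<open>ct c\<close> obeys the Riccati equation
  \<open>ct' = - c - ct\<^sup>2\<close>. The reciprocal is a generator because the algebra has no
  division.\<close>

lemma is_solution_smooth:
  assumes "is_solution n \<mu> c \<rho> f" and c: "c \<le> 0"
  shows "smooth_on {0<..<\<rho>} f"
proof -
  obtain f1 f2 where f: "\<And>r. r \<in> {0<..\<rho>} \<Longrightarrow> (f has_real_derivative f1 r) (at r within {0<..\<rho>})"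
    and f1: "\<And>r. r \<in> {0<..\<rho>} \<Longrightarrow> (f1 has_real_derivative f2 r) (at r within {0<..\<rho>})"
    and f2: "\<And>r. r \<in> {0<..\<rho>} \<Longrightarrow> f2 r + (real n - 1) * f1 r * ct c r + \<mu> * (f r / r\<^sup>2) + 1 = 0"
    using assms unfolding is_solution_def by blast
  have at: "at r within {0<..\<rho>} = at r" if "r \<in> {0<..<\<rho>}" for r
    by (rule at_within_open_subset[of _ "{0<..<\<rho>}"]) (use that in auto)
  let ?F = "{f, f1, ct c, \<lambda>r. 1 / r}"
  note intros = ode_algebra.intros
  have in_F: "f \<in> ode_algebra ?F" "f1 \<in> ode_algebra ?F" "ct c \<in> ode_algebra ?F" "(\<lambda>r. 1 / r) \<in> ode_algebra ?F"
    by (auto intro: ode_algebra.base)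
  have d1: "(f1 has_real_derivative (- (real n - 1)) * (f1 r * ct c r) + (- \<mu>) * (f r * (1 / r * (1 / r))) + - 1) (at r)"
    if r: "r \<in> {0<..<\<rho>}" for r
  proof -
    have "f2 r = (- (real n - 1)) * (f1 r * ct c r) + (- \<mu>) * (f r * (1 / r * (1 / r))) + - 1"
      using f2[of r] r by (simp add: power2_eq_square algebra_simps)
    then show ?thesis
      using f1[of r] at[OF r] r by simp
  qed
  have d2: "(ct c has_real_derivative - c + - 1 * (ct c r * ct c r)) (at r)" if r: "r \<in> {0<..<\<rho>}" for r
  proof -
    have S: "0 < sn (sqrt (- c)) r"
      using r by (simp add: sn_pos)
    have "((\<lambda>r. cs (sqrt (- c)) r / sn (sqrt (- c)) r) has_real_derivative
        - c + - 1 * (ct c r * ct c r)) (at r)"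
      unfolding ct_eq using S c
      by (auto intro!: derivative_eq_intros simp: divide_simps power2_eq_square)
    then show ?thesis
      by (simp add: ct_eq[abs_def])
  qed
  have d3: "((\<lambda>r. 1 / r) has_real_derivative - 1 * (1 / r * (1 / r))) (at r)" if "r \<in> {0<..<\<rho>}" for r :: real
    using that by (auto intro!: derivative_eq_intros simp: power2_eq_square)
  have e1: "(\<lambda>r. (- (real n - 1)) * (f1 r * ct c r) + (- \<mu>) * (f r * (1 / r * (1 / r))) + - 1) \<in> ode_algebra ?F"
    and e2: "(\<lambda>r. - c + - 1 * (ct c r * ct c r)) \<in> ode_algebra ?F"
    and e3: "(\<lambda>r. - 1 * (1 / r * (1 / r))) \<in> ode_algebra ?F"
    by (intro intros(2-4) in_F)+
  show ?thesis
  proof (rule smooth_on_ode_algebra)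
    fix g assume "g \<in> ?F"
    then consider "g = f" | "g = f1" | "g = ct c" | "g = (\<lambda>r. 1 / r)"
      by auto
    then show "\<exists>g'\<in>ode_algebra ?F. \<forall>r\<in>{0<..<\<rho>}. (g has_real_derivative g' r) (at r)"
    proof cases
      case 1
      have "(f has_real_derivative f1 r) (at r)" if "r \<in> {0<..<\<rho>}" for r
        using f[of r] at[OF that] that by simp
      then show ?thesis
        using 1 in_F(2) by blast
    next
      case 2
      show ?thesis
        unfolding 2 by (rule bexI[OF _ e1]) (use d1 in blast)
    next
      case 3
      show ?thesis
        unfolding 3 by (rule bexI[OF _ e2]) (use d2 in blast)
    next
      case 4
      show ?thesis
        unfolding 4 by (rule bexI[OF _ e3]) (use d3 in blast)
    qed
  qed (use in_F in auto)
qed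

text \<open>Derivatives within the interval see only values on it, and \<open>0 < \<rho>\<close>
  places the boundary point inside it. This permits replacing \<open>sol\<close> by its
  restriction.\<close>

lemma is_solution_cong:
  assumes "is_solution n \<mu> c \<rho> f" and eq: "\<And>r. r \<in> {0<..\<rho>} \<Longrightarrow> g r = f r" and "0 < \<rho>"
  shows "is_solution n \<mu> c \<rho> g"
proof -
  have "(g has_real_derivative D) (at r within {0<..\<rho>}) \<longleftrightarrow> (f has_real_derivative D) (at r within {0<..\<rho>})"
    if "r \<in> {0<..\<rho>}" for r D
    using eq that by (intro has_field_derivative_cong_eventually) (auto simp: eventually_at_filter)
  with assms show ?thesis
    unfolding is_solution_def by (smt (verit, best) greaterThanAtMost_iff)
qed

text \<open>Requiring \<open>extensional\<close> picks one total function for each function on the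
  interval, so that uniqueness can be stated as equality. The qualitative claims hold for every
  representative.\<close>

theorem proposition5p2:
  fixes n :: nat and \<mu> c \<rho> :: real
  assumes "n \<ge> 3"
    and "0 \<le> \<mu>" and "\<mu> < (real n - 2)\<^sup>2 / 4"
    and "c \<le> 0" and "\<rho> > 0"
  shows "(\<exists>!f. f \<in> extensional {0<..\<rho>} \<and> is_solution n \<mu> c \<rho> f) \<and>
         (\<forall>f. is_solution n \<mu> c \<rho> f \<longrightarrow>
            (\<forall>r\<in>{0<..\<rho>}. f r \<ge> 0) \<and>
            antimono_on {0<..\<rho>} f \<and>
            smooth_on {0<..<\<rho>} f)"
proof -
  define k where "k = sqrt (- c)"
  \<comment> \<open>The root of the discriminant of \<open>t (n - 2 - t) = \<mu>\<close>, positive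
    because \<open>\<mu>\<close> is subcritical; the smaller root \<open>a\<close> then satisfies
    \<open>2 a < n - 2\<close> strictly.\<close>
  define d where "d = sqrt ((real n - 2)\<^sup>2 - 4 * \<mu>)"
  define a where "a = (real n - 2 - d) / 2"
  have d: "0 < d" "d\<^sup>2 = (real n - 2)\<^sup>2 - 4 * \<mu>"
    using assms by (auto simp: d_def)
  have "d \<le> real n - 2"
    by (rule power2_le_imp_le) (use assms in \<open>simp_all add: d\<close>)
  then have a: "0 \<le> a" "2 * a < real n - 2"
    using d by (auto simp: a_def)
  have \<mu>: "a * (real n - 2 - a) = \<mu>"
    using d(2) by (simp add: a_def power2_eq_square field_simps)
  obtain \<phi> \<phi>1 B where "homogeneous_profile n k a \<rho> B \<phi> \<phi>1"
    by (rule homogeneous_solution[OF a \<open>\<rho> > 0\<close>], rule that, unfold_locales;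
        (assumption | rule assms(1) assms(5) a))
  then interpret homogeneous_profile n k a \<rho> B \<phi> \<phi>1 .
  have ct: "ct c r = cs k r / S r" for r
    by (simp add: ct_eq k_def)
  have sol: "is_solution n \<mu> c \<rho> sol"
    unfolding is_solution_def ct \<mu>[symmetric]
  proof (intro exI conjI ballI)
    have alg: "(- p * x * u - M * v / z - 1) + p * u * x + M * (v / z) + 1 = 0" for p x u M v z :: real
      by (simp add: algebra_simps)
    show "(- (real n - 1) * (cs k r / S r) * sol1 r - a * (real n - 2 - a) * sol r / r\<^sup>2 - 1)
      + (real n - 1) * sol1 r * (cs k r / S r) + a * (real n - 2 - a) * (sol r / r\<^sup>2) + 1 = 0" for r
      by (rule alg)
  qed (fact sol_deriv sol1_deriv sol_boundary sol_energy)+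
  have unique: "f r = sol r" if "is_solution n \<mu> c \<rho> f" "r \<in> {0<..\<rho>}" for f r
    using that(1) unfolding is_solution_def ct \<mu>[symmetric]
    by (elim exE conjE, intro sol_unique[OF _ _ _ _ _ that(2)]) blast+
  have anti: "antimono_on {0<..\<rho>} sol"
    by (rule antimono_on_if_deriv_nonpos[OF sol_deriv sol1_nonpos])
  show ?thesis
  proof (intro conjI allI impI ballI)
    show "\<exists>!f. f \<in> extensional {0<..\<rho>} \<and> is_solution n \<mu> c \<rho> f"
    proof (rule ex1I[of _ "restrict sol {0<..\<rho>}"])
      show "restrict sol {0<..\<rho>} \<in> extensional {0<..\<rho>} \<and> is_solution n \<mu> c \<rho> (restrict sol {0<..\<rho>})"
        using is_solution_cong[OF sol _ \<open>\<rho> > 0\<close>] by auto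
      fix f assume "f \<in> extensional {0<..\<rho>} \<and> is_solution n \<mu> c \<rho> f"
      then show "f = restrict sol {0<..\<rho>}"
        using unique by (intro extensionalityI[of f "{0<..\<rho>}"]) auto
    qed
    fix f assume f: "is_solution n \<mu> c \<rho> f"
    show "0 \<le> f r" if "r \<in> {0<..\<rho>}" for r
      using unique[OF f that] sol_nonneg[OF that] by simp
    show "antimono_on {0<..\<rho>} f"
      using anti unique[OF f] by (auto simp: monotone_on_def)
    show "smooth_on {0<..<\<rho>} f"
      using f \<open>c \<le> 0\<close> by (rule is_solution_smooth)
  qed
qed

end
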